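(* Let $d\ge 1$ be an integer and let $\mathcal{D}$ be a random $d$-partite hyper-graph model with internal parameter $t$ and concentration constant $h>0$ which admits a $(c,\lambda,\theta)$-approximate median. Let $0\le \eta\le \min\{\lambda/(d-1),\theta-\lambda\}$ and let $g:\mathbb{R}\to\mathbb{R}$ satisfy $g(t)=O(t^{\eta})$ as $t\to\infty$. For positive integers $n_1,\dots,n_d$ write $N=(\prod_{i=1}^d n_i)^{1/d}$ and $S=\sum_{i=1}^d n_i$. Then for every $\epsilon>0$ there exist $t_0$ and $A$ (not depending on $n_1,\dots,n_d$ or $t$) such that for every $t\ge t_0$ and all positive integers $n_1,\dots,n_d$ with $N\ge A t^{\lambda}$ (size constraint) and $S\le g(t)N$ (balance condition), writing $L=L(\mathcal{D}_t(K_{n_1,\dots,n_d}))$: (i) $(1-\epsilon)\frac{cN}{t^\lambda}\le \mathbb{E}[L]\le (1+\epsilon)\frac{cN}{t^\lambda}$; (ii) every median $\mathrm{Med}$ of $L$ satisfies $(1-\epsilon)\frac{cN}{t^\lambda}\le \mathrm{Med}\le (1+\epsilon)\frac{cN}{t^\lambda}$; (iii) there is a constant $K>0$ such that $\Pr[L\le (1-\epsilon)\frac{cN}{t^\lambda}]\le \exp(-Kh\epsilon^2\frac{cN}{t^\lambda})$ and $\Pr[L\ge (1+\epsilon)\frac{cN}{t^\lambda}]\le \exp(-Kh\frac{\epsilon^2}{1+\epsilon}\frac{cN}{t^\lambda})$. Moreover, if $\mathcal{D}$ is only a weak random $d$-partite hyper-graph model with internal parameter $t$, concentration constant $h$, admitting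 a $(c,\lambda,\theta)$-approximate median (with the definitions specialized to $n_1=\dots=n_d=n$), then for $n_1=\dots=n_d=n$ the lower bound in (i), the lower bound in (ii), and the first (lower tail) inequality in (iii) still hold.
   Context: A $d$-partite hyper-graph over finite totally ordered disjoint color classes $A_1,\dots,A_d$ is $G=(A_1,\dots,A_d;E)$ with $E\subseteq A_1\times\cdots\times A_d$. $K_{n_1,\dots,n_d}$ is the complete one with $A_i=[n_i]$ (natural order) and all edges; $K^{(d)}_n=K_{n,\dots,n}$. For $A_i'\subseteq A_i$, the induced hyper-subgraph $G|_{A_1'\times\cdots\times A_d'}$ has color classes $A_i'$ (with inherited order) and edge set $E\cap(A_1'\times\cdots\times A_d')$. Edges are partially ordered by $(v_1,\dots,v_d)\preceq(v_1',\dots,v_d')$ iff $v_i\le v_i'$ for all $i$. A non-crossing hyper-matching is a set of pairwise vertex-disjoint edges any two of which are comparable under $\preceq$; $L(G)$ is the maximum size of a non-crossing hyper-matching of $G$, and for a distribution $\mathcal{F}$, $L(\mathcal{F})$ is the random variable $L(G)$, $G\sim\mathcal{F}$. A random $d$-partite hyper-graph model is a family $\mathcal{D}=(\mathcal{D}(K_{A_1,\dots,A_d}))$ of distributions over hyper-subgraphs of $K_{A_1,\dots,A_d}$ such that for $H\sim \mathcal{D}(K_{A_1,\dots,A_d})$: (monotonicity) if $A_i'\subseteq A_i$ with $|A_i'|=n_i'$, then $H|_{A_1'\times\cdots\times A_d'}$ (with each $A_i'$ identified with $[n_i']$ order-preservingly) has distribution $\mathcal{D}(K_{n_1',\dots,n_d'})$;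 (block independence) if $A_i',A_i''\subseteq A_i$ are disjoint for each $i$, then $H|_{A_1'\times\cdots\times A_d'}$ and $H|_{A_1''\times\cdots\times A_d''}$ are independent. A weak random $d$-partite hyper-graph model is a family $(\mathcal{D}(K^{(d)}_n))_n$ with the same two properties required only when $A_1'=\dots=A_d'=A'\subseteq[n]$ and $A_1''=\dots=A_d''=A''\subseteq[n]$. A model with internal parameter $t$ means a family of such models $\mathcal{D}_t$, one for each value of the real parameter $t$ (e.g. $t=1/p$); the subscript $t$ is often suppressed. A distribution $\mathcal{F}$ has concentration constant $h$ if for every median $\mathrm{Med}$ of $L(\mathcal{F})$ and every $s\ge 0$: $\Pr[L(\mathcal{F})\le(1-s)\mathrm{Med}]\le 2\exp(-hs^2\mathrm{Med})$ and $\Pr[L(\mathcal{F})\ge(1+s)\mathrm{Med}]\le 2\exp(-h\frac{s^2}{1+s}\mathrm{Med})$; a model has concentration constant $h$ if every distribution in it (for every $t$) does. The model admits a $(c,\lambda,\theta)$-approximate median if for every $\delta>0$ there are constants $a(\delta),b(\delta),t'(\delta)$ such that for all $t\ge t'$ and all positive integers $n_1,\dots,n_d$ with geometric mean $N$ and sum $S$ satisfying $N\ge a t^{\lambda}$ and $Sb\le t^{\theta}$, every median of $L(\mathcal{D}_t(K_{n_1,\dots,n_d}))$ lies in $[(1-\delta)cN/t^{\lambda},(1+\delta)cN/t^{\lambda}]$.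
   Formalization: Proved for η < θ−λ strictly (the claim fails at η = θ−λ, e.g. for the empty model when λ = θ), with c > 0 and λ ≥ 0 assumed; for d = 1 the bound η ≤ λ/(d−1) is read as no condition. *)

theory Defs
  imports "HOL-Probability.Probability" "HOL-Library.Landau_Symbols"
begin

text \<open>
  The color classes are indexed by a finite type \<open>'d\<close>, so the number of classes is \<open>CARD('d)\<close>. The vertices of
  each class are natural numbers; classes with different indices are disjoint because a vertex
  occurs in an edge only together with its position. An edge is a function \<open>'d \<Rightarrow> nat\<close>, the order
  on edges is the pointwise order on functions, and a hyper-graph on given color
  classes is its set of edges.
\<close>

definition box :: "('d \<Rightarrow> nat set) \<Rightarrow> ('d \<Rightarrow> nat) set" where
  "box A = {e. \<forall>i. e i \<in> A i}"

definition complete_hypergraph :: "('d \<Rightarrow> nat) \<Rightarrow> ('d \<Rightarrow> nat) set" where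
  "complete_hypergraph n = box (\<lambda>i. {1..n i})"

definition induced :: "('d \<Rightarrow> nat set) \<Rightarrow> ('d \<Rightarrow> nat) set \<Rightarrow> ('d \<Rightarrow> nat) set" where
  "induced A H = H \<inter> box A"

text \<open>On each finite \<open>A i\<close>, \<open>v \<mapsto> card {w \<in> A i. w \<le> v}\<close> is the order isomorphism onto
  \<open>{1..card (A i)}\<close>.\<close>

definition relabel :: "('d \<Rightarrow> nat set) \<Rightarrow> ('d \<Rightarrow> nat) \<Rightarrow> ('d \<Rightarrow> nat)" where
  "relabel A e = (\<lambda>i. card {w \<in> A i. w \<le> e i})"

definition noncrossing_matching :: "('d \<Rightarrow> nat) set \<Rightarrow> ('d \<Rightarrow> nat) set \<Rightarrow> bool" where
  "noncrossing_matching H M \<longleftrightarrow>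
     M \<subseteq> H \<and> (\<forall>e\<in>M. \<forall>f\<in>M. e \<noteq> f \<longrightarrow> (\<forall>i. e i \<noteq> f i) \<and> (e \<le> f \<or> f \<le> e))"

definition L :: "('d \<Rightarrow> nat) set \<Rightarrow> nat" where
  "L H = Max {card M | M. noncrossing_matching H M}"

text \<open>The distribution for arbitrary finite totally ordered color classes is determined, through
  monotonicity, by the one for the classes \<open>{1..n i}\<close>; hence a model is indexed by the sizes.\<close>

definition random_hypergraph_model ::
    "(('d::finite \<Rightarrow> nat) \<Rightarrow> ('d \<Rightarrow> nat) set pmf) \<Rightarrow> bool" where
  "random_hypergraph_model D \<longleftrightarrow>
     (\<forall>n. set_pmf (D n) \<subseteq> Pow (complete_hypergraph n)) \<and>
     (\<forall>n A. (\<forall>i. A i \<subseteq> {1..n i}) \<longrightarrow>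
        map_pmf (\<lambda>H. relabel A ` induced A H) (D n) = D (\<lambda>i. card (A i))) \<and>
     (\<forall>n A B. (\<forall>i. A i \<subseteq> {1..n i} \<and> B i \<subseteq> {1..n i} \<and> A i \<inter> B i = {}) \<longrightarrow>
        prob_space.indep_var (measure_pmf (D n))
          (count_space UNIV) (induced A) (count_space UNIV) (induced B))"

definition weak_random_hypergraph_model ::
    "(nat \<Rightarrow> ('d::finite \<Rightarrow> nat) set pmf) \<Rightarrow> bool" where
  "weak_random_hypergraph_model W \<longleftrightarrow>
     (\<forall>n. set_pmf (W n) \<subseteq> Pow (complete_hypergraph (\<lambda>_. n))) \<and>
     (\<forall>n A. A \<subseteq> {1..n} \<longrightarrow>
        map_pmf (\<lambda>H. relabel (\<lambda>_. A) ` induced (\<lambda>_. A) H) (W n) = W (card A)) \<and>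
     (\<forall>n A B. A \<subseteq> {1..n} \<and> B \<subseteq> {1..n} \<and> A \<inter> B = {} \<longrightarrow>
        prob_space.indep_var (measure_pmf (W n))
          (count_space UNIV) (induced (\<lambda>_. A)) (count_space UNIV) (induced (\<lambda>_. B)))"

definition is_median_L :: "('d \<Rightarrow> nat) set pmf \<Rightarrow> real \<Rightarrow> bool" where
  "is_median_L F m \<longleftrightarrow>
     measure_pmf.prob F {H. real (L H) \<le> m} \<ge> 1 / 2 \<and>
     measure_pmf.prob F {H. real (L H) \<ge> m} \<ge> 1 / 2"

definition concentration_constant :: "('d \<Rightarrow> nat) set pmf \<Rightarrow> real \<Rightarrow> bool" where
  "concentration_constant F h \<longleftrightarrow>
     (\<forall>m s. is_median_L F m \<longrightarrow> s \<ge> 0 \<longrightarrow>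
        measure_pmf.prob F {H. real (L H) \<le> (1 - s) * m} \<le> 2 * exp (- h * s\<^sup>2 * m) \<and>
        measure_pmf.prob F {H. real (L H) \<ge> (1 + s) * m} \<le> 2 * exp (- h * (s\<^sup>2 / (1 + s)) * m))"

definition geo_mean :: "('d::finite \<Rightarrow> nat) \<Rightarrow> real" where
  "geo_mean n = (\<Prod>i\<in>UNIV. real (n i)) powr (1 / real CARD('d))"

definition class_size_sum :: "('d::finite \<Rightarrow> nat) \<Rightarrow> real" where
  "class_size_sum n = (\<Sum>i\<in>UNIV. real (n i))"

definition approximate_median ::
    "(real \<Rightarrow> ('d::finite \<Rightarrow> nat) \<Rightarrow> ('d \<Rightarrow> nat) set pmf) \<Rightarrow> real \<Rightarrow> real \<Rightarrow> real \<Rightarrow> bool" where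
  "approximate_median D c lam \<theta> \<longleftrightarrow>
     (\<forall>\<delta>>0. \<exists>a b t'. \<forall>t\<ge>t'. \<forall>n. (\<forall>i. n i > 0) \<longrightarrow>
        geo_mean n \<ge> a * t powr lam \<longrightarrow> class_size_sum n * b \<le> t powr \<theta> \<longrightarrow>
        (\<forall>m. is_median_L (D t n) m \<longrightarrow>
           m \<in> {(1 - \<delta>) * (c * geo_mean n / t powr lam) .. (1 + \<delta>) * (c * geo_mean n / t powr lam)}))"

definition weak_approximate_median ::
    "(real \<Rightarrow> nat \<Rightarrow> ('d::finite \<Rightarrow> nat) set pmf) \<Rightarrow> real \<Rightarrow> real \<Rightarrow> real \<Rightarrow> bool" where
  "weak_approximate_median W c lam \<theta> \<longleftrightarrow>
     (\<forall>\<delta>>0. \<exists>a b t'. \<forall>t\<ge>t'. \<forall>n>0.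
        real n \<ge> a * t powr lam \<longrightarrow> real CARD('d) * real n * b \<le> t powr \<theta> \<longrightarrow>
        (\<forall>m. is_median_L (W t n) m \<longrightarrow>
           m \<in> {(1 - \<delta>) * (c * real n / t powr lam) .. (1 + \<delta>) * (c * real n / t powr lam)}))"

end

theory Submission imports Defs "HOL-Real_Asymp.Real_Asymp" begin

text \<open>
  Lower bound: cut the classes into \<open>q\<close> consecutive blocks of equal size, with geometric mean of
  order \<open>M * t powr lam\<close> for a large constant \<open>M\<close>. The balance condition makes these blocks fall into
  the range of the median hypothesis, and \<open>\<eta> \<le> lam / (d - 1)\<close> keeps every class of a block large, so
  rounding is harmless. Since \<open>L\<close> is superadditive over consecutive blocks, the expectation is at
  least \<open>q\<close> times that of one block; concentration makes expectation and median interchangeable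
  once the median is large, which it is because it is already large on a single block. Independence
  is not used, so the argument covers weak models.

  Upper bound: let \<open>\<tau> = (\<theta> - lam - \<eta>) / 4\<close> and \<open>r \<approx> t powr \<tau>\<close>. Either the median hypothesis applies
  directly, or \<open>N\<close> is so large that \<open>\<mu> / r\<close> is large. In the latter case a matching of size
  \<open>q * r \<approx> (1 + \<epsilon>) * \<mu>\<close> splits into \<open>q\<close> groups of \<open>r\<close> consecutive edges, which cut the classes into
  \<open>q\<close> blocks, each with \<open>L \<ge> r\<close>. By the arithmetic-geometric mean inequality the geometric means of the
  blocks sum to at most \<open>N\<close>, so a positive fraction of the blocks has median well below \<open>r\<close>; for
  each of these \<open>L \<ge> r\<close> has probability \<open>exp (- \<Omega>(t powr \<tau>))\<close>, and the blocks are independent. This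
  beats the number of ways to choose the blocks, which is polynomial in \<open>t\<close> per block.
\<close>

section \<open>Non-crossing matchings and blocks\<close>

lemma finite_complete_hypergraph: "finite (complete_hypergraph (n :: 'd::finite \<Rightarrow> nat))"
proof -
  have "complete_hypergraph n = (\<Pi>\<^sub>E i\<in>UNIV. {1..n i})"
    by (auto simp: complete_hypergraph_def box_def)
  then show ?thesis by (simp add: finite_PiE)
qed

lemma noncrossing_matching_mono:
  "noncrossing_matching H M \<Longrightarrow> H \<subseteq> H' \<Longrightarrow> M' \<subseteq> M \<Longrightarrow> noncrossing_matching H' M'"
  by (auto simp: noncrossing_matching_def) blast+

lemma finite_matching_sizes:
  assumes "finite H"
  shows "finite {card M | M. noncrossing_matching H M}"
proof (rule finite_subset)
  show "{card M | M. noncrossing_matching H M} \<subseteq> card ` Pow H"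
    by (auto simp: noncrossing_matching_def)
qed (use assms in auto)

lemma card_le_L: "finite H \<Longrightarrow> noncrossing_matching H M \<Longrightarrow> card M \<le> L H"
  unfolding L_def using finite_matching_sizes by (intro Max_ge) auto

lemma L_witness:
  assumes "finite H"
  obtains M where "noncrossing_matching H M" "card M = L H"
proof -
  have "{card M | M. noncrossing_matching H M} \<noteq> {}"
    by (auto simp: noncrossing_matching_def)
  then have "L H \<in> {card M | M. noncrossing_matching H M}"
    unfolding L_def using finite_matching_sizes[OF assms] by (intro Max_in)
  then show ?thesis using that by auto
qed

lemma L_mono:
  assumes "finite H'" "H \<subseteq> H'"
  shows "L H \<le> L H'"
proof -
  obtain M where "noncrossing_matching H M" "card M = L H"
    using L_witness[of H] finite_subset[OF assms(2,1)] by auto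
  then show ?thesis
    using card_le_L[OF assms(1), of M] noncrossing_matching_mono[OF _ assms(2) order_refl] by force
qed

text \<open>A map that preserves and reflects \<open><\<close> in every coordinate does the same
  with \<open>=\<close> and \<open>\<le>\<close>. It is therefore injective on \<open>H\<close>, and
  the matchings of the image are exactly the images of the matchings of \<open>H\<close>.\<close>

lemma L_image:
  fixes f :: "('d \<Rightarrow> nat) \<Rightarrow> ('d \<Rightarrow> nat)"
  assumes f: "\<And>e e' i. e \<in> H \<Longrightarrow> e' \<in> H \<Longrightarrow> f e i < f e' i \<longleftrightarrow> e i < e' i"
  shows "L (f ` H) = L H"
proof -
  have eq: "f e i = f e' i \<longleftrightarrow> e i = e' i" if "e \<in> H" "e' \<in> H" for e e' i
    using f[of e e' i] f[of e' e i] that by (metis linorder_neq_iff)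
  have le: "f e \<le> f e' \<longleftrightarrow> e \<le> e'" if "e \<in> H" "e' \<in> H" for e e'
    using f[of e' e] that by (auto simp: le_fun_def not_less[symmetric])
  have inj: "inj_on f H"
    by (rule inj_onI) (metis eq ext)
  have iff: "noncrossing_matching (f ` H) (f ` M) \<longleftrightarrow> noncrossing_matching H M" if M: "M \<subseteq> H" for M
  proof -
    have 1: "f e \<noteq> f e' \<longleftrightarrow> e \<noteq> e'" if "e \<in> M" "e' \<in> M" for e e'
      using inj M that by (auto dest: inj_onD)
    show ?thesis
      unfolding noncrossing_matching_def using M 1 eq le by (auto simp: subset_iff)
  qed
  have "noncrossing_matching (f ` H) M \<longleftrightarrow> (\<exists>M'. M = f ` M' \<and> noncrossing_matching H M')" for M
  proof
    assume M: "noncrossing_matching (f ` H) M"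
    then have "M \<subseteq> f ` H" by (simp add: noncrossing_matching_def)
    then obtain M' where "M' \<subseteq> H" "M = f ` M'" by (metis subset_imageE)
    then show "\<exists>M'. M = f ` M' \<and> noncrossing_matching H M'" using M iff by metis
  next
    assume "\<exists>M'. M = f ` M' \<and> noncrossing_matching H M'"
    then obtain M' where M': "M = f ` M'" "noncrossing_matching H M'" by metis
    then have "M' \<subseteq> H" by (simp add: noncrossing_matching_def)
    then show "noncrossing_matching (f ` H) M" using iff M' by metis
  qed
  moreover have "card (f ` M) = card M" if "noncrossing_matching H M" for M
  proof -
    have "M \<subseteq> H" using that by (simp add: noncrossing_matching_def)
    then show ?thesis by (rule card_image[OF inj_on_subset[OF inj]])
  qed
  ultimately have "{card M | M. noncrossing_matching (f ` H) M} = {card M | M. noncrossing_matching H M}"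
    by metis
  then show ?thesis by (simp add: L_def)
qed

text \<open>Passing to ranks is strictly monotone on each finite class. This lets the monotonicity
  axiom, which speaks of relabelled graphs, be used for \<open>L\<close> of an induced
  subgraph.\<close>

lemma L_relabel:
  fixes A :: "'d \<Rightarrow> nat set"
  assumes "\<And>i. finite (A i)"
  shows "L (relabel A ` induced A H) = L (induced A H)"
proof (rule L_image)
  have less: "card {w \<in> A i. w \<le> x} < card {w \<in> A i. w \<le> y}" if "x < y" "y \<in> A i" for x y i
  proof (rule psubset_card_mono)
    have "y \<in> {w \<in> A i. w \<le> y}" "y \<notin> {w \<in> A i. w \<le> x}" using that by auto
    then show "{w \<in> A i. w \<le> x} \<subset> {w \<in> A i. w \<le> y}" using that by fastforce
  qed (use assms[of i] in auto)
  fix e e' i assume "e \<in> induced A H" "e' \<in> induced A H"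
  then have "e i \<in> A i" "e' i \<in> A i" by (auto simp: induced_def box_def)
  then show "relabel A e i < relabel A e' i \<longleftrightarrow> e i < e' i"
    unfolding relabel_def using less[of "e i" "e' i" i] less[of "e' i" "e i" i]
    by (cases "e i" "e' i" rule: linorder_cases) auto
qed

text \<open>Optimal matchings of the blocks can be united: edges from different blocks differ in the
  same direction in all coordinates, so the union is disjoint and non-crossing.\<close>

lemma L_superadditive:
  fixes A :: "nat \<Rightarrow> 'd \<Rightarrow> nat set"
  assumes H: "finite H"
    and A: "\<And>k l i x y. k < l \<Longrightarrow> l < q \<Longrightarrow> x \<in> A k i \<Longrightarrow> y \<in> A l i \<Longrightarrow> x < y"
  shows "(\<Sum>k<q. L (induced (A k) H)) \<le> L H"
proof -
  have fin: "finite (induced (A k) H)" for k using H by (auto simp: induced_def)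
  have "\<exists>M. noncrossing_matching (induced (A k) H) M \<and> card M = L (induced (A k) H)" for k
    using L_witness[OF fin] by metis
  then obtain M where M: "\<And>k. noncrossing_matching (induced (A k) H) (M k)"
    "\<And>k. card (M k) = L (induced (A k) H)" by metis
  have sub: "M k \<subseteq> H" "\<And>e i. e \<in> M k \<Longrightarrow> e i \<in> A k i" for k
    using M(1)[of k] by (auto simp: noncrossing_matching_def induced_def box_def)
  have finM: "finite (M k)" for k using sub H finite_subset by blast
  have blk: "e i < f i" if "e \<in> M k" "f \<in> M l" "k < l" "l < q" for e f k l i
    using A[OF that(3,4)] sub that by blast
  have disj: "M k \<inter> M l = {}" if "k < q" "l < q" "k \<noteq> l" for k l
  proof (rule ccontr)
    assume "M k \<inter> M l \<noteq> {}"
    then obtain e where "e \<in> M k" "e \<in> M l" by auto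
    then show False using blk[of e k e l] blk[of e l e k] that
      by (metis less_irrefl linorder_neq_iff)
  qed
  have nc: "noncrossing_matching H (\<Union>k<q. M k)"
    unfolding noncrossing_matching_def
  proof (intro conjI ballI impI)
    show "(\<Union>k<q. M k) \<subseteq> H" using sub by blast
    fix e f assume "e \<in> (\<Union>k<q. M k)" "f \<in> (\<Union>k<q. M k)" and ne: "e \<noteq> f"
    then obtain k l where kl: "k < q" "l < q" "e \<in> M k" "f \<in> M l" by auto
    have "(\<forall>i. e i \<noteq> f i) \<and> (e \<le> f \<or> f \<le> e)"
    proof (cases k l rule: linorder_cases)
      case less
      then have "e i < f i" for i using blk kl by blast
      then show ?thesis by (metis le_funI less_imp_le less_irrefl)
    next
      case equal
      then show ?thesis using M(1)[of k] kl ne by (auto simp: noncrossing_matching_def)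
    next
      case greater
      then have "f i < e i" for i using blk kl by blast
      then show ?thesis by (metis le_funI less_imp_le less_irrefl)
    qed
    then show "\<forall>i. e i \<noteq> f i" "e \<le> f \<or> f \<le> e" by auto
  qed
  have "(\<Sum>k<q. L (induced (A k) H)) = card (\<Union>k<q. M k)"
    using disj finM by (subst card_UN_disjoint) (auto simp: M)
  also have "\<dots> \<le> L H" by (rule card_le_L[OF H nc])
  finally show ?thesis .
qed

text \<open>The cut points \<open>V i\<close> are the right ends of the blocks: in class \<open>i\<close>, block \<open>j\<close> runs from just
  after the \<open>j\<close>-th cut point up to and including the next one.\<close>

definition cut_block :: "('d \<Rightarrow> nat) \<Rightarrow> ('d \<Rightarrow> nat set) \<Rightarrow> nat \<Rightarrow> 'd \<Rightarrow> nat set" where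
  "cut_block n V j i = {x \<in> {1..n i}. card {v \<in> V i. v < x} = j}"

text \<open>Ranks start at 0, so the edges that complete a group of \<open>r\<close> are those of
  rank \<open>k\<close> with \<open>r dvd Suc k\<close>; this counts the completed groups.\<close>

lemma card_multiples_below:
  assumes "r > 0"
  shows "card {k. k < m \<and> r dvd Suc k} = m div r"
proof (induction m)
  case (Suc m)
  have "{k. k < Suc m \<and> r dvd Suc k} =
      (if r dvd Suc m then insert m {k. k < m \<and> r dvd Suc k} else {k. k < m \<and> r dvd Suc k})"
    by (auto simp: less_Suc_eq)
  then show ?case using Suc by (auto simp: div_Suc dvd_eq_mod_eq_0)
qed simp

lemma rank_bij:
  fixes X :: "'a set" and f :: "'a \<Rightarrow> nat"
  assumes "finite X" "inj_on f X"
  shows "bij_betw (\<lambda>x. card {y \<in> X. f y < f x}) X {..<card X}"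
    and "\<And>x x'. x \<in> X \<Longrightarrow> x' \<in> X \<Longrightarrow>
      card {y \<in> X. f y < f x} < card {y \<in> X. f y < f x'} \<longleftrightarrow> f x < f x'"
proof -
  have less: "card {y \<in> X. f y < f x} < card {y \<in> X. f y < f x'}" if "x \<in> X" "f x < f x'" for x x'
    using that assms(1) by (intro psubset_card_mono) auto
  show iff: "card {y \<in> X. f y < f x} < card {y \<in> X. f y < f x'} \<longleftrightarrow> f x < f x'"
    if "x \<in> X" "x' \<in> X" for x x'
    using less[of x x'] less[of x' x] that by (cases "f x" "f x'" rule: linorder_cases) auto
  have inj: "inj_on (\<lambda>x. card {y \<in> X. f y < f x}) X"
  proof (rule inj_onI)
    fix x x' assume x: "x \<in> X" "x' \<in> X" "card {y \<in> X. f y < f x} = card {y \<in> X. f y < f x'}"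
    then have "f x = f x'" using iff[of x x'] iff[of x' x] by (metis linorder_neq_iff)
    then show "x = x'" using assms(2) x by (auto dest: inj_onD)
  qed
  have "card {y \<in> X. f y < f x} < card X" if "x \<in> X" for x
    using that assms(1) by (intro psubset_card_mono) auto
  then have sub: "(\<lambda>x. card {y \<in> X. f y < f x}) ` X \<subseteq> {..<card X}" by auto
  then have "(\<lambda>x. card {y \<in> X. f y < f x}) ` X = {..<card X}"
    using inj by (intro card_subset_eq) (auto simp: card_image)
  then show "bij_betw (\<lambda>x. card {y \<in> X. f y < f x}) X {..<card X}"
    using inj by (simp add: bij_betw_def)
qed

text \<open>The \<open>j\<close>-th cut point, counted from 0, has exactly \<open>j\<close> cut
  points strictly before it and so belongs to block \<open>j\<close>.\<close>

lemma cut_block_nonempty: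
  assumes V: "V i \<subseteq> {1..n i}" "card (V i) = q" and j: "j < q"
  shows "cut_block n V j i \<noteq> {}"
proof -
  have "finite (V i)" using V finite_subset by blast
  from rank_bij(1)[OF this, of id]
  have "j \<in> (\<lambda>x. card {y \<in> V i. y < x}) ` V i" using V(2) j by (auto simp: bij_betw_def)
  then obtain x where "x \<in> V i" "card {y \<in> V i. y < x} = j" by auto
  then have "x \<in> cut_block n V j i" using V(1) by (auto simp: cut_block_def)
  then show ?thesis by auto
qed

text \<open>Number a matching of exactly \<open>q * r\<close> edges along its chain and take as cut
  points the coordinates of the last edge of each group of \<open>r\<close>. Each group then lies in
  one block and is a matching there.\<close>

lemma L_ge_imp_blocks:
  fixes n :: "'d \<Rightarrow> nat"
  assumes H: "finite H" "H \<subseteq> complete_hypergraph n" and r: "r > 0" and L: "q * r \<le> L H"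
  obtains V where "\<And>i. V i \<subseteq> {1..n i}" "\<And>i. card (V i) = q"
    "\<And>j. j < q \<Longrightarrow> r \<le> L (induced (cut_block n V j) H)"
proof -
  obtain M0 where M0: "noncrossing_matching H M0" "card M0 = L H" using L_witness[OF H(1)] .
  obtain M where M: "M \<subseteq> M0" "card M = q * r" using L M0(2) by (metis obtain_subset_with_card_n)
  have nc: "noncrossing_matching H M" using noncrossing_matching_mono[OF M0(1) order_refl M(1)] .
  then have MH: "M \<subseteq> H" by (simp add: noncrossing_matching_def)
  then have finM: "finite M" using H finite_subset by blast
  have inj: "inj_on (\<lambda>e. e i) M" for i
    using nc by (auto simp: noncrossing_matching_def intro!: inj_onI)
  \<comment> \<open>Distinct edges of a non-crossing matching are comparable and differ everywhere,
    so every coordinate orders the matching in the same way.\<close>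
  have coord: "e i < f i \<longleftrightarrow> e j < f j" if "e \<in> M" "f \<in> M" for e f i j
  proof (cases "e = f")
    case False
    then have "e i \<noteq> f i" "e j \<noteq> f j" "e \<le> f \<or> f \<le> e"
      using nc that unfolding noncrossing_matching_def by blast+
    then consider "e i < f i" "e j < f j" | "f i < e i" "f j < e j"
      by (metis le_funD le_neq_implies_less)
    then show ?thesis by cases auto
  qed simp
  \<comment> \<open>Since the coordinates agree on the order, an arbitrary class may define the
    rank.\<close>
  define i0 :: 'd where "i0 = undefined"
  define rk where "rk = (\<lambda>e. card {f \<in> M. f i0 < e i0})"
  have bij: "bij_betw rk M {..<q * r}"
    using rank_bij(1)[OF finM inj[of i0]] M(2) by (simp add: rk_def)
  have rk: "rk e < rk f \<longleftrightarrow> e i < f i" if "e \<in> M" "f \<in> M" for e f i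
    using rank_bij(2)[OF finM inj[of i0]] that coord[OF that, of i i0] by (simp add: rk_def)
  have count: "card {e \<in> M. P (rk e)} = card {k. k < q * r \<and> P k}" for P
  proof -
    have "rk ` {e \<in> M. P (rk e)} = {k \<in> rk ` M. P k}" by auto
    also have "\<dots> = {k. k < q * r \<and> P k}" using bij by (auto simp: bij_betw_def)
    finally have "bij_betw rk {e \<in> M. P (rk e)} {k. k < q * r \<and> P k}"
      using bij_betw_subset[OF bij, of "{e \<in> M. P (rk e)}"] by auto
    then show ?thesis by (rule bij_betw_same_card)
  qed
  define V where "V i = (\<lambda>e. e i) ` {e \<in> M. r dvd Suc (rk e)}" for i
  have rk_less: "rk e < q * r" if "e \<in> M" for e using bij that by (auto simp: bij_betw_def)
  \<comment> \<open>The number of cut points before \<open>e\<close> is the number of groups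
    completed before \<open>e\<close>, whatever the class \<open>i\<close>; hence all coordinates of
    \<open>e\<close> fall in the block with the same index.\<close>
  have below: "card {v \<in> V i. v < e i} = rk e div r" if e: "e \<in> M" for e i
  proof -
    have "{v \<in> V i. v < e i} = (\<lambda>e. e i) ` {f \<in> M. rk f < rk e \<and> r dvd Suc (rk f)}"
      using rk[OF _ e] by (auto simp: V_def)
    then have "card {v \<in> V i. v < e i} = card {f \<in> M. rk f < rk e \<and> r dvd Suc (rk f)}"
      by (simp add: card_image inj_on_subset[OF inj])
    also have "\<dots> = card {k. k < q * r \<and> k < rk e \<and> r dvd Suc k}" by (rule count)
    also have "{k. k < q * r \<and> k < rk e \<and> r dvd Suc k} = {k. k < rk e \<and> r dvd Suc k}"
      using rk_less[OF e] by auto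
    finally show ?thesis by (simp add: card_multiples_below[OF r])
  qed
  have bnd: "e i \<in> {1..n i}" if "e \<in> M" for e i
    using that MH H(2) by (auto simp: complete_hypergraph_def box_def subset_iff)
  show ?thesis
  proof (rule that)
    fix i
    show "V i \<subseteq> {1..n i}" using bnd by (auto simp: V_def)
    have "card (V i) = card {e \<in> M. r dvd Suc (rk e)}"
      unfolding V_def by (intro card_image inj_on_subset[OF inj]) auto
    also have "\<dots> = q" 
      using card_multiples_below[OF r, of "q * r"] r count[of "\<lambda>k. r dvd Suc k"] by simp
    finally show "card (V i) = q" .
  next
    fix j assume j: "j < q"
    let ?M = "{e \<in> M. rk e div r = j}"
    have "{k. k < q * r \<and> k div r = j} = {j * r..<Suc j * r}"
    proof -
      have le: "Suc j * r \<le> q * r" using j by (intro mult_right_mono) auto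
      have iff: "k div r = j \<longleftrightarrow> j * r \<le> k \<and> k < Suc j * r" for k
      proof
        assume "k div r = j"
        then show "j * r \<le> k \<and> k < Suc j * r"
          using r dividend_less_div_times[of r k] by (auto simp: add.commute)
      qed (auto intro!: div_nat_eqI simp: mult.commute)
      show ?thesis unfolding iff by (auto simp del: mult_Suc intro: less_le_trans[OF _ le])
    qed
    then have "card ?M = r" using count[of "\<lambda>k. k div r = j"] by simp
    moreover have "?M \<subseteq> induced (cut_block n V j) H"
      using MH below bnd by (force simp: induced_def box_def cut_block_def)
    then have "noncrossing_matching (induced (cut_block n V j) H) ?M"
      using noncrossing_matching_mono[OF nc order_refl, of ?M]
      by (simp add: noncrossing_matching_def)
    ultimately show "r \<le> L (induced (cut_block n V j) H)"
      using card_le_L[of "induced (cut_block n V j) H" ?M] H(1) by (simp add: induced_def)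
  qed
qed

section \<open>Medians, expectations and block independence\<close>

lemma finite_set_pmf_hypergraph:
  "set_pmf F \<subseteq> Pow (complete_hypergraph (n :: 'd::finite \<Rightarrow> nat)) \<Longrightarrow> finite (set_pmf F)"
  by (erule finite_subset) (simp add: finite_complete_hypergraph)

lemma measure_pmf_mono:
  assumes "\<And>x. x \<in> set_pmf F \<Longrightarrow> x \<in> A \<Longrightarrow> x \<in> B"
  shows "measure_pmf.prob F A \<le> measure_pmf.prob F B"
  using assms by (intro measure_pmf.finite_measure_mono_AE) (auto simp: AE_measure_pmf_iff)

lemma expectation_pmf_mono:
  fixes f g :: "'a \<Rightarrow> real"
  assumes "finite (set_pmf F)" "\<And>x. x \<in> set_pmf F \<Longrightarrow> f x \<le> g x"
  shows "measure_pmf.expectation F f \<le> measure_pmf.expectation F g"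
  using assms by (intro integral_mono_AE) (auto simp: AE_measure_pmf_iff integrable_measure_pmf_finite)

text \<open>The least natural number \<open>k\<close> such that \<open>L \<le> k\<close> has
  probability at least one half works: if \<open>k > 0\<close>, minimality gives
  \<open>L \<le> k - 1\<close> probability below one half, which leaves more than one half for
  \<open>L \<ge> k\<close>.\<close>

lemma median_exists:
  assumes fin: "finite (set_pmf F)"
  obtains m where "is_median_L F m"
proof -
  let ?P = "\<lambda>k::nat. measure_pmf.prob F {H. L H \<le> k} \<ge> 1 / 2"
  have "measure_pmf.prob F {H. L H \<le> Max (L ` set_pmf F)} = 1"
    using fin by (subst measure_pmf.prob_eq_1) (auto simp: AE_measure_pmf_iff)
  then have ex: "?P (Max (L ` set_pmf F))" by simp
  define k where "k = (LEAST k. ?P k)"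
  have k: "?P k" unfolding k_def using ex by (rule LeastI)
  have "measure_pmf.prob F {H. L H \<ge> k} \<ge> 1 / 2"
  proof (cases k)
    case 0
    then show ?thesis by simp
  next
    case (Suc j)
    then have "\<not> ?P j" unfolding k_def using not_less_Least[of j ?P] by auto
    moreover have "measure_pmf.prob F (UNIV - {H. L H \<le> j}) = 1 - measure_pmf.prob F {H. L H \<le> j}"
      using measure_pmf.prob_compl[of "{H. L H \<le> j}" F] by simp
    moreover have "UNIV - {H. L H \<le> j} = {H. L H \<ge> k}" using Suc by auto
    ultimately have "measure_pmf.prob F {H. k \<le> L H} = 1 - measure_pmf.prob F {H. L H \<le> j}"
      by metis
    with \<open>\<not> ?P j\<close> show ?thesis by linarith
  qed
  then have "is_median_L F (real k)" using k by (simp add: is_median_L_def)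
  then show ?thesis by (rule that)
qed

lemma half_powers_sum_le: "(\<Sum>k=1..K. (1/2::real) ^ k) \<le> 1"
proof -
  have "(\<Sum>k=1..K. (1/2::real) ^ k) = 1 - (1/2) ^ K" by (induction K) auto
  then show ?thesis by simp
qed

lemma lower_tailD:
  assumes "concentration_constant F h" "is_median_L F m" "s \<ge> 0"
  shows "measure_pmf.prob F {H. real (L H) \<le> (1 - s) * m} \<le> 2 * exp (- h * s\<^sup>2 * m)"
  using assms by (simp add: concentration_constant_def)

lemma upper_tailD:
  assumes "concentration_constant F h" "is_median_L F m" "s \<ge> 0"
  shows "measure_pmf.prob F {H. real (L H) \<ge> (1 + s) * m} \<le> 2 * exp (- h * (s\<^sup>2 / (1 + s)) * m)"
  using assms by (simp add: concentration_constant_def)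

text \<open>For \<open>r = (1 + s) * m\<close> the exponent equals
  \<open>h * (s / (1 + s))\<^sup>2 * r\<close>, and \<open>s / (1 + s)\<close> increases with
  \<open>s\<close>. The resulting bound depends on the threshold and not on \<open>m\<close>, which
  matters for blocks whose median is very small.\<close>

lemma upper_tail_far:
  assumes cc: "concentration_constant F h" and m: "is_median_L F m" "0 < m"
    and h: "h \<ge> 0" and \<sigma>: "0 < \<sigma>" "(1 + \<sigma>) * m \<le> r"
  shows "measure_pmf.prob F {H. real (L H) \<ge> r} \<le> 2 * exp (- (h * (\<sigma> / (1 + \<sigma>))\<^sup>2 * r))"
proof -
  define s where "s = r / m - 1"
  have r: "(1 + s) * m = r" using m by (simp add: s_def)
  have s: "\<sigma> \<le> s" using \<sigma> m by (simp add: s_def field_simps)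
  have "\<sigma> / (1 + \<sigma>) \<le> s / (1 + s)" using s \<sigma> by (simp add: field_simps)
  then have "(\<sigma> / (1 + \<sigma>))\<^sup>2 \<le> (s / (1 + s))\<^sup>2" using \<sigma> by (intro power_mono) auto
  moreover have "0 \<le> r" using s \<sigma> m r by (metis add_nonneg_nonneg less_eq_real_def mult_nonneg_nonneg order_trans zero_le_one)
  ultimately have "h * (\<sigma> / (1 + \<sigma>))\<^sup>2 * r \<le> h * (s / (1 + s))\<^sup>2 * r"
    using h by (intro mult_right_mono mult_left_mono) auto
  also have "\<dots> = h * (s\<^sup>2 / (1 + s)) * m"
    using s \<sigma> by (simp add: r[symmetric] power2_eq_square)
  finally have "2 * exp (- h * (s\<^sup>2 / (1 + s)) * m) \<le> 2 * exp (- (h * (\<sigma> / (1 + \<sigma>))\<^sup>2 * r))"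
    by simp
  moreover have "measure_pmf.prob F {H. real (L H) \<ge> r} \<le> 2 * exp (- h * (s\<^sup>2 / (1 + s)) * m)"
    using upper_tailD[OF cc m(1), of s] s \<sigma> unfolding r by linarith
  ultimately show ?thesis by linarith
qed

text \<open>The upper estimate sums the upper tail over the levels \<open>(1 + k * u) * m\<close>, where it decays
  geometrically.\<close>

lemma expectation_near_median:
  assumes h: "h > 0" and s: "0 < s" "s \<le> 1"
  obtains R where "R \<ge> 1" "\<forall>(F :: ('d \<Rightarrow> nat) set pmf) m.
     finite (set_pmf F) \<longrightarrow> concentration_constant F h \<longrightarrow> is_median_L F m \<longrightarrow> R \<le> m \<longrightarrow>
     (1 - s) * m \<le> measure_pmf.expectation F (\<lambda>H. real (L H)) \<and>
     measure_pmf.expectation F (\<lambda>H. real (L H)) \<le> (1 + s) * m"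
proof -
  \<comment> \<open>The upper estimate loses \<open>u\<close> in the offset and \<open>2 * u\<close>
    in the geometric series, hence a third of \<open>s\<close>; the lower estimate uses
    \<open>(1 - u)\<^sup>2 \<ge> 1 - s\<close>.\<close>
  define u where "u = s / 3"
  have u: "0 < u" "u \<le> 1 / 3" using s by (auto simp: u_def)
  \<comment> \<open>For \<open>m \<ge> R\<close> the term \<open>2 * ln 2\<close> makes the tail at
    level \<open>k\<close> at most \<open>2 * (1/2) ^ k\<close>, and \<open>ln (2 / u)\<close> makes
    the lower tail at most \<open>u\<close>.\<close>
  define R where "R = max 1 ((2 * ln 2 + ln (2 / u)) / (h * u\<^sup>2))"
  show ?thesis
  proof (rule that[of R]; (intro allI impI)?)
    show "R \<ge> 1" by (simp add: R_def)
  next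
    fix F :: "('d \<Rightarrow> nat) set pmf" and m
    assume fin: "finite (set_pmf F)" and cc: "concentration_constant F h"
      and med: "is_median_L F m" and R: "R \<le> m"
    have m: "m \<ge> 1" using R by (simp add: R_def)
    have hum: "2 * ln 2 + ln (2 / u) \<le> h * u\<^sup>2 * m"
      using R h u by (auto simp: R_def field_simps)
    have lnu: "ln (2 / u) > 0" using u by (intro ln_gt_zero) (simp add: field_simps)
    have ln2: "ln 2 > (0::real)" by simp
    let ?E = "measure_pmf.expectation F (\<lambda>H. real (L H))"
    have lower: "(1 - s) * m \<le> ?E"
    proof -
      let ?S = "{H. real (L H) \<le> (1 - u) * m}"
      have "measure_pmf.prob F ?S \<le> 2 * exp (- h * u\<^sup>2 * m)"
        using lower_tailD[OF cc med] u by simp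
      also have "\<dots> \<le> 2 * exp (- ln (2 / u))" using hum ln2 by (simp, linarith)
      also have "\<dots> = u" using u by (simp add: exp_minus)
      finally have P: "measure_pmf.prob F ?S \<le> u" .
      have "(1 - s) * m \<le> ((1 - u) * m) * (1 - u)"
        using m u by (simp add: u_def power2_eq_square algebra_simps)
      also have "\<dots> \<le> ((1 - u) * m) * (1 - measure_pmf.prob F ?S)"
        using P m u by (intro mult_left_mono) auto
      also have "1 - measure_pmf.prob F ?S = measure_pmf.prob F (UNIV - ?S)"
        using measure_pmf.prob_compl[of ?S F] by simp
      also have "((1 - u) * m) * measure_pmf.prob F (UNIV - ?S)
          = measure_pmf.expectation F (\<lambda>H. ((1 - u) * m) * indicator (UNIV - ?S) H)"
        by simp
      also have "\<dots> \<le> ?E"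
        using fin by (intro expectation_pmf_mono) (auto simp: indicator_def)
      finally show ?thesis .
    qed
    have upper: "?E \<le> (1 + s) * m"
    proof -
      define B where "B = Max (L ` set_pmf F)"
      define K where "K = nat \<lceil>real B / (u * m)\<rceil>"
      define T where "T k = {H :: ('d \<Rightarrow> nat) set. real (L H) \<ge> (1 + real k * u) * m}" for k :: nat
      have um: "u * m > 0" using u m by simp
      \<comment> \<open>Layer-cake bound: each full step of length \<open>u * m\<close> above
        \<open>m\<close> counts one indicator, the offset \<open>(1 + u) * m\<close> covers the last
        incomplete step, and \<open>K\<close> steps suffice because \<open>L \<le> B\<close> on the
        finite support.\<close>
      have pw: "real (L H) \<le> (1 + u) * m + u * m * (\<Sum>k=1..K. indicator (T k) H)"
        if H: "H \<in> set_pmf F" for H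
      proof (cases "real (L H) \<le> (1 + u) * m")
        case True
        moreover have "0 \<le> u * m * (\<Sum>k=1..K. indicator (T k) H)"
          using u m by (intro mult_nonneg_nonneg sum_nonneg) auto
        ultimately show ?thesis by linarith
      next
        case False
        define k0 where "k0 = nat \<lfloor>(real (L H) - m) / (u * m)\<rfloor>"
        have LB: "L H \<le> B" unfolding B_def using fin H by auto
        have pos: "0 \<le> (real (L H) - m) / (u * m)"
          using False um unfolding distrib_right by (intro divide_nonneg_pos) linarith+
        then have fl: "real k0 \<le> (real (L H) - m) / (u * m)" "(real (L H) - m) / (u * m) < real k0 + 1"
          unfolding k0_def by linarith+
        have "(real (L H) - m) / (u * m) \<le> real B / (u * m)"
          using LB m um by (intro divide_right_mono) auto
        also have "\<dots> \<le> real K" unfolding K_def by linarith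
        finally have k0K: "k0 \<le> K" using fl by linarith
        have inT: "H \<in> T k" if "k \<le> k0" for k
        proof -
          have "real k * (u * m) \<le> real k0 * (u * m)" using that um by (intro mult_right_mono) auto
          also have "\<dots> \<le> real (L H) - m" using fl(1) um by (simp add: field_simps)
          finally show ?thesis by (simp add: T_def algebra_simps)
        qed
        have "real k0 = (\<Sum>k=1..k0. indicator (T k) H)" using inT by simp
        also have "\<dots> \<le> (\<Sum>k=1..K. indicator (T k) H)"
          using k0K by (intro sum_mono2) auto
        finally have "u * m * real k0 \<le> u * m * (\<Sum>k=1..K. indicator (T k) H)"
          using um by (intro mult_left_mono) auto
        moreover have "real (L H) - m \<le> (real k0 + 1) * (u * m)" using fl(2) um by (simp add: field_simps)
        ultimately show ?thesis by (simp add: algebra_simps)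
      qed
      have tail: "measure_pmf.prob F (T k) \<le> 2 * (1/2) ^ k" if k: "k \<ge> 1" for k
      proof -
        \<comment> \<open>For \<open>k \<ge> 1\<close> this makes
          \<open>(k * u)\<^sup>2 / (1 + k * u)\<close> at least linear in \<open>k\<close>, which
          gives the geometric decay.\<close>
        have "1 + real k * u \<le> 2 * real k" using k u mult_left_mono[of u 1 "real k"] by linarith
        then have "real k * u\<^sup>2 * (1 + real k * u) \<le> real k * u\<^sup>2 * (2 * real k)"
          by (intro mult_left_mono) auto
        then have ge: "real k * u\<^sup>2 / 2 \<le> (real k * u)\<^sup>2 / (1 + real k * u)"
          using k u by (simp add: field_simps power2_eq_square add_pos_pos)
        have "real k * ln 2 \<le> real k * (h * u\<^sup>2 * m / 2)"
          using hum lnu by (intro mult_left_mono) auto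
        also have "\<dots> = h * (real k * u\<^sup>2 / 2) * m" by simp
        also have "\<dots> \<le> h * ((real k * u)\<^sup>2 / (1 + real k * u)) * m"
          using ge h m by (intro mult_right_mono mult_left_mono) auto
        finally have *: "exp (- h * ((real k * u)\<^sup>2 / (1 + real k * u)) * m) \<le> exp (- (real k * ln 2))"
          by simp
        have "exp (- (real k * ln 2)) = (1/2::real) ^ k"
          by (simp add: exp_minus exp_of_nat_mult power_divide inverse_eq_divide)
        then show ?thesis
          using upper_tailD[OF cc med, of "real k * u"] u * by (simp add: T_def)
      qed
      have "?E \<le> measure_pmf.expectation F (\<lambda>H. (1 + u) * m + u * m * (\<Sum>k=1..K. indicator (T k) H))"
        using fin pw by (intro expectation_pmf_mono)
      also have "\<dots> = (1 + u) * m + u * m * (\<Sum>k=1..K. measure_pmf.prob F (T k))"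
        using fin by (simp add: integrable_measure_pmf_finite)
      also have "\<dots> \<le> (1 + u) * m + u * m * (\<Sum>k=1..K. 2 * (1/2) ^ k)"
        using um tail by (intro add_left_mono mult_left_mono sum_mono) auto
      also have "\<dots> \<le> (1 + u) * m + u * m * 2"
        using um half_powers_sum_le[of K] unfolding sum_distrib_left[symmetric]
        by (intro add_left_mono mult_left_mono) auto
      also have "\<dots> = (1 + s) * m" by (simp add: u_def algebra_simps)
      finally show ?thesis .
    qed
    show "(1 - s) * m \<le> ?E \<and> ?E \<le> (1 + s) * m" using lower upper by simp
  qed
qed

section \<open>Transfer to sub-blocks and independence of blocks\<close>

lemma prob_L_induced:
  assumes "map_pmf (\<lambda>H. relabel A ` induced A H) F = F'" "\<And>i. finite (A i)"
  shows "measure_pmf.prob F {H. P (L (induced A H))} = measure_pmf.prob F' {H. P (L H)}"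
  unfolding assms(1)[symmetric] by (simp add: vimage_def L_relabel[OF assms(2)])

lemma expectation_L_induced:
  assumes "map_pmf (\<lambda>H. relabel A ` induced A H) F = F'" "\<And>i. finite (A i)"
  shows "measure_pmf.expectation F (\<lambda>H. real (L (induced A H)))
       = measure_pmf.expectation F' (\<lambda>H. real (L H))"
  unfolding assms(1)[symmetric] by (simp add: L_relabel[OF assms(2)])

context
  fixes D :: "('d::finite \<Rightarrow> nat) \<Rightarrow> ('d \<Rightarrow> nat) set pmf"
  assumes model: "random_hypergraph_model D"
begin

lemma model_support: "set_pmf (D n) \<subseteq> Pow (complete_hypergraph n)"
  using model by (simp add: random_hypergraph_model_def)

lemma model_map:
  "(\<And>i. A i \<subseteq> {1..n i}) \<Longrightarrow>
    map_pmf (\<lambda>H. relabel A ` induced A H) (D n) = D (\<lambda>i. card (A i))"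
  using model by (simp add: random_hypergraph_model_def)

lemma model_indep:
  "(\<And>i. A i \<subseteq> {1..n i} \<and> B i \<subseteq> {1..n i} \<and> A i \<inter> B i = {}) \<Longrightarrow>
    prob_space.indep_var (measure_pmf (D n))
      (count_space UNIV) (induced A) (count_space UNIV) (induced B)"
  using model by (simp add: random_hypergraph_model_def)

text \<open>The restriction of a sample of \<open>D n'\<close> to the initial segments of lengths
  \<open>n i\<close> has law \<open>D n\<close>, so both events live on one space, and
  \<open>L\<close> can only grow from the restriction to the whole sample.\<close>

lemma upper_tail_mono:
  assumes "n \<le> n'"
  shows "measure_pmf.prob (D n) {H. r \<le> L H} \<le> measure_pmf.prob (D n') {H. r \<le> L H}"
proof -
  let ?A = "\<lambda>i. {1..n i}"
  have "map_pmf (\<lambda>H. relabel ?A ` induced ?A H) (D n') = D n"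
    using model_map[of ?A n'] assms by (auto simp: le_fun_def)
  from prob_L_induced[OF this, where P = "\<lambda>l. r \<le> l"]
  have "measure_pmf.prob (D n) {H. r \<le> L H} = measure_pmf.prob (D n') {H. r \<le> L (induced ?A H)}"
    by simp
  also have "\<dots> \<le> measure_pmf.prob (D n') {H. r \<le> L H}"
  proof (rule measure_pmf_mono, clarify)
    fix H assume "H \<in> set_pmf (D n')" "r \<le> L (induced ?A H)"
    then have "finite H" using model_support[of n'] finite_complete_hypergraph finite_subset by blast
    then show "r \<le> L H" using L_mono[of H "induced ?A H"] \<open>r \<le> _\<close> by (auto simp: induced_def)
  qed
  finally show ?thesis .
qed

text \<open>The axiom covers two blocks, so the product is built by induction: the union
  \<open>U\<close> of the first \<open>p\<close> blocks is disjoint from block \<open>p\<close>, and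
  the event on the first \<open>p\<close> blocks depends only on the restriction to
  \<open>U\<close>.\<close>

lemma prob_blocks_indep:
  fixes A :: "nat \<Rightarrow> 'd \<Rightarrow> nat set"
  assumes A: "\<And>j i. A j i \<subseteq> {1..n i}" and disj: "\<And>j k i. j \<noteq> k \<Longrightarrow> A j i \<inter> A k i = {}"
  shows "measure_pmf.prob (D n) {H. \<forall>j<p. r \<le> L (induced (A j) H)}
       = (\<Prod>j<p. measure_pmf.prob (D (\<lambda>i. card (A j i))) {H. r \<le> L H})"
proof (induction p)
  case (Suc p)
  define U where "U i = (\<Union>j<p. A j i)" for i
  let ?X = "{H. \<forall>j<p. r \<le> L (induced (A j) H)}" and ?Y = "{H. r \<le> L H}"
  have sub: "induced (A j) (induced U H) = induced (A j) H" if "j < p" for j H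
    using that by (auto simp: induced_def box_def U_def)
  have ind: "prob_space.indep_var (measure_pmf (D n))
      (count_space UNIV) (induced U) (count_space UNIV) (induced (A p))"
  proof (rule model_indep)
    fix i
    have "A j i \<inter> A p i = {}" if "j < p" for j using disj that by auto
    then show "U i \<subseteq> {1..n i} \<and> A p i \<subseteq> {1..n i} \<and> U i \<inter> A p i = {}"
      unfolding U_def using A by blast
  qed
  have "{H. \<forall>j<Suc p. r \<le> L (induced (A j) H)} = (\<lambda>H. (induced U H, induced (A p) H)) -` (?X \<times> ?Y)"
    using sub by (auto simp: less_Suc_eq)
  then have "measure_pmf.prob (D n) {H. \<forall>j<Suc p. r \<le> L (induced (A j) H)}
      = measure_pmf.prob (D n) (induced U -` ?X) * measure_pmf.prob (D n) (induced (A p) -` ?Y)"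
    using prob_space.indep_varD[OF measure_pmf.prob_space_axioms ind, of ?X ?Y] by simp
  also have "induced U -` ?X = ?X" using sub by auto
  also have "measure_pmf.prob (D n) (induced (A p) -` ?Y)
      = measure_pmf.prob (D (\<lambda>i. card (A p i))) ?Y"
    using prob_L_induced[OF model_map[of "A p" n], where P = "\<lambda>l. r \<le> l"] A
    by (simp add: vimage_def finite_subset[OF A])
  finally show ?case using Suc by simp
qed simp

end

section \<open>Geometric means and growth conditions\<close>

lemma geo_mean_nonneg [simp]: "geo_mean n \<ge> 0"
  by (simp add: geo_mean_def)

lemma geo_mean_pos: "(\<And>i. n i > 0) \<Longrightarrow> geo_mean n > 0"
  by (simp add: geo_mean_def prod_pos)

lemma geo_mean_power: "geo_mean (n :: 'd::finite \<Rightarrow> nat) ^ CARD('d) = (\<Prod>i\<in>UNIV. real (n i))"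
proof (cases "(\<Prod>i\<in>UNIV. real (n i)) = 0")
  case False
  then have P: "(\<Prod>i\<in>UNIV. real (n i)) > 0" by (simp add: prod_pos)
  then have "geo_mean n > 0" unfolding geo_mean_def by (metis powr_gt_zero less_irrefl)
  then have "geo_mean n ^ CARD('d) = geo_mean n powr real CARD('d)" by (simp add: powr_realpow)
  also have "\<dots> = (\<Prod>i\<in>UNIV. real (n i))" using P by (simp add: geo_mean_def powr_powr)
  finally show ?thesis .
next
  case True
  show ?thesis unfolding geo_mean_def True by simp
qed

lemma geo_mean_ge:
  fixes n w :: "'d::finite \<Rightarrow> nat"
  assumes "x \<ge> 0" "\<And>i. x * real (n i) \<le> real (w i)"
  shows "x * geo_mean n \<le> geo_mean w"
proof -
  have "(x * geo_mean n) ^ CARD('d) = (\<Prod>i\<in>UNIV. x * real (n i))"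
    by (simp add: power_mult_distrib geo_mean_power prod.distrib)
  also have "\<dots> \<le> (\<Prod>i\<in>UNIV. real (w i))" using assms by (intro prod_mono) auto
  also have "\<dots> = geo_mean w ^ CARD('d)" by (simp add: geo_mean_power)
  finally show ?thesis using assms by (subst (asm) power_mono_iff) auto
qed

lemma geo_mean_le:
  fixes n w :: "'d::finite \<Rightarrow> nat"
  assumes "x \<ge> 0" "\<And>i. real (w i) \<le> x * real (n i)"
  shows "geo_mean w \<le> x * geo_mean n"
proof -
  have "geo_mean w ^ CARD('d) = (\<Prod>i\<in>UNIV. real (w i))" by (simp add: geo_mean_power)
  also have "\<dots> \<le> (\<Prod>i\<in>UNIV. x * real (n i))" using assms by (intro prod_mono) auto
  also have "\<dots> = (x * geo_mean n) ^ CARD('d)"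
    by (simp add: power_mult_distrib geo_mean_power prod.distrib)
  finally show ?thesis using assms by (subst (asm) power_mono_iff) auto
qed

lemma geo_mean_const: "geo_mean (\<lambda>_ :: 'd::finite. k) = real k"
proof -
  have "geo_mean (\<lambda>_ :: 'd. k) ^ CARD('d) = real k ^ CARD('d)"
    by (simp add: geo_mean_power)
  then show ?thesis by (subst (asm) power_eq_iff_eq_base) auto
qed

lemma class_size_le_sum: "real (n i) \<le> class_size_sum n"
  unfolding class_size_sum_def by (rule member_le_sum) auto

text \<open>In the product of the sizes every factor except \<open>n i\<close> is at most
  \<open>\<gamma> * geo_mean n\<close>; cancelling the common power of the geometric mean shows that
  balance keeps every single class large.\<close>

lemma geo_mean_le_class_size:
  fixes n :: "'d::finite \<Rightarrow> nat"
  assumes n: "\<And>i. n i > 0" and S: "class_size_sum n \<le> \<gamma> * geo_mean n"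
  shows "geo_mean n \<le> real (n i) * \<gamma> ^ (CARD('d) - 1)"
proof -
  let ?N = "geo_mean n"
  have N: "?N > 0" using geo_mean_pos n by blast
  have "?N * ?N ^ (CARD('d) - 1) = ?N ^ CARD('d)"
    by (metis power_minus_mult zero_less_card_finite mult.commute)
  also have "\<dots> = real (n i) * (\<Prod>j\<in>UNIV - {i}. real (n j))"
    by (subst geo_mean_power, subst prod.remove[of _ i]) auto
  also have "(\<Prod>j\<in>UNIV - {i}. real (n j)) \<le> (\<Prod>j\<in>UNIV - {i}. \<gamma> * ?N)"
    using class_size_le_sum[of n] S by (intro prod_mono) (auto intro: order_trans)
  also have "\<dots> = \<gamma> ^ (CARD('d) - 1) * ?N ^ (CARD('d) - 1)"
    by (simp add: card_Diff_singleton power_mult_distrib)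
  finally have "?N * ?N ^ (CARD('d) - 1) \<le> (real (n i) * \<gamma> ^ (CARD('d) - 1)) * ?N ^ (CARD('d) - 1)"
    by (simp add: mult_left_mono mult.assoc)
  then show ?thesis using N by (simp add: mult_le_cancel_right_pos)
qed

text \<open>The arithmetic-geometric mean inequality for the ratios \<open>a j i / n i\<close>, summed over \<open>j\<close>.\<close>

lemma sum_geo_mean_le:
  fixes n :: "'d::finite \<Rightarrow> nat" and a :: "'b \<Rightarrow> 'd \<Rightarrow> nat"
  assumes n: "\<And>i. n i > 0" and J: "finite J" and a: "\<And>i. (\<Sum>j\<in>J. a j i) \<le> n i"
  shows "(\<Sum>j\<in>J. geo_mean (a j)) \<le> geo_mean n"
proof -
  let ?d = "real CARD('d)" and ?N = "geo_mean n"
  have N: "?N > 0" using geo_mean_pos n by blast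
  have "geo_mean (a j) / ?N \<le> (\<Sum>i\<in>UNIV. real (a j i) / real (n i) / ?d)" for j
  proof -
    have "geo_mean (a j) / ?N = (\<Prod>i\<in>UNIV. real (a j i) / real (n i)) powr (1 / ?d)"
      by (simp add: geo_mean_def prod_dividef powr_divide prod_nonneg)
    also have "\<dots> \<le> (\<Sum>i\<in>UNIV. real (a j i) / real (n i) / ?d)"
      using arith_geom_mean[of UNIV "\<lambda>i. real (a j i) / real (n i)"] by simp
    finally show ?thesis .
  qed
  then have "(\<Sum>j\<in>J. geo_mean (a j) / ?N) \<le> (\<Sum>j\<in>J. \<Sum>i\<in>UNIV. real (a j i) / real (n i) / ?d)"
    by (rule sum_mono)
  also have "\<dots> = (\<Sum>i\<in>UNIV. real (\<Sum>j\<in>J. a j i) / real (n i) / ?d)"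
    by (subst sum.swap) (simp add: sum_divide_distrib)
  also have "\<dots> \<le> (\<Sum>i\<in>(UNIV::'d set). 1 / ?d)"
  proof (rule sum_mono)
    fix i :: 'd
    have "real (\<Sum>j\<in>J. a j i) / real (n i) \<le> 1" using a[of i] n[of i] by (simp del: of_nat_sum)
    then show "real (\<Sum>j\<in>J. a j i) / real (n i) / ?d \<le> 1 / ?d" by (intro divide_right_mono) auto
  qed
  also have "\<dots> = 1" by simp
  finally show ?thesis using N by (simp add: field_simps flip: sum_divide_distrib)
qed

section \<open>Growth in \<open>t\<close> and the median hypothesis on a set of size vectors\<close>

lemma eventually_powr_dominates:
  fixes C \<alpha> \<beta> :: real
  assumes "\<alpha> < \<beta>"
  shows "\<forall>\<^sub>F t in at_top. C * t powr \<alpha> \<le> t powr \<beta>"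
proof -
  have "((\<lambda>t::real. t powr (\<alpha> - \<beta>)) \<longlongrightarrow> 0) at_top"
    using assms by real_asymp
  then have "\<forall>\<^sub>F t in at_top. t powr (\<alpha> - \<beta>) < 1 / (\<bar>C\<bar> + 1)"
    by (rule order_tendstoD) simp
  then show ?thesis using eventually_gt_at_top[of 0]
  proof eventually_elim
    case (elim t)
    have "C * t powr (\<alpha> - \<beta>) \<le> (\<bar>C\<bar> + 1) * t powr (\<alpha> - \<beta>)" by (intro mult_right_mono) auto
    also have "\<dots> \<le> 1" using elim by (simp add: field_simps)
    finally have "C * t powr (\<alpha> - \<beta>) * t powr \<beta> \<le> 1 * t powr \<beta>" by (intro mult_right_mono) auto
    then show ?case by (simp add: mult.assoc flip: powr_add)
  qed
qed

text \<open>Restricting the sizes to a set \<open>C\<close> lets one proof of the lower bound serve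
  both kinds of model: \<open>C\<close> is everything for a random model and the set of constant
  vectors for a weak one.\<close>

definition approximate_median_on ::
    "('d::finite \<Rightarrow> nat) set \<Rightarrow> (real \<Rightarrow> ('d \<Rightarrow> nat) \<Rightarrow> ('d \<Rightarrow> nat) set pmf) \<Rightarrow> real \<Rightarrow> real \<Rightarrow> real \<Rightarrow> bool" where
  "approximate_median_on C D c lam \<theta> \<longleftrightarrow>
     (\<forall>\<delta>>0. \<exists>a b t'. \<forall>t\<ge>t'. \<forall>n\<in>C. (\<forall>i. n i > 0) \<longrightarrow>
        geo_mean n \<ge> a * t powr lam \<longrightarrow> class_size_sum n * b \<le> t powr \<theta> \<longrightarrow>
        (\<forall>m. is_median_L (D t n) m \<longrightarrow>
           m \<in> {(1 - \<delta>) * (c * geo_mean n / t powr lam) .. (1 + \<delta>) * (c * geo_mean n / t powr lam)}))"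

text \<open>Raising \<open>a\<close> and \<open>b\<close> to at least 1 only shrinks the set of
  admissible sizes, as \<open>t powr lam\<close> and the sum of the sizes are nonnegative.\<close>

lemma approximate_median_onE:
  assumes "approximate_median_on C D c lam \<theta>" "\<delta> > 0"
  obtains a b t' where "a \<ge> 1" "b \<ge> 1"
    "\<forall>t n m. t \<ge> t' \<longrightarrow> n \<in> C \<longrightarrow> (\<forall>i. n i > 0) \<longrightarrow> geo_mean n \<ge> a * t powr lam \<longrightarrow>
       class_size_sum n * b \<le> t powr \<theta> \<longrightarrow> is_median_L (D t n) m \<longrightarrow>
       (1 - \<delta>) * (c * geo_mean n / t powr lam) \<le> m \<and> m \<le> (1 + \<delta>) * (c * geo_mean n / t powr lam)"
proof -
  from assms obtain a b t' where *: "\<And>t n m. t \<ge> t' \<Longrightarrow> n \<in> C \<Longrightarrow> \<forall>i. n i > 0 \<Longrightarrow>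
      geo_mean n \<ge> a * t powr lam \<Longrightarrow> class_size_sum n * b \<le> t powr \<theta> \<Longrightarrow> is_median_L (D t n) m \<Longrightarrow>
      (1 - \<delta>) * (c * geo_mean n / t powr lam) \<le> m \<and> m \<le> (1 + \<delta>) * (c * geo_mean n / t powr lam)"
    unfolding approximate_median_on_def by (metis atLeastAtMost_iff)
  show ?thesis
  proof (rule that[of "max a 1" "max b 1" t']; (intro allI impI)?)
    fix t m and n :: "'a \<Rightarrow> nat"
    assume A: "t \<ge> t'" "n \<in> C" "\<forall>i. n i > 0" "geo_mean n \<ge> max a 1 * t powr lam"
      "class_size_sum n * max b 1 \<le> t powr \<theta>" "is_median_L (D t n) m"
    have "a * t powr lam \<le> max a 1 * t powr lam" by (intro mult_right_mono) auto
    moreover have "class_size_sum n * b \<le> class_size_sum n * max b 1"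
      by (intro mult_left_mono) (auto simp: class_size_sum_def sum_nonneg)
    ultimately show "(1 - \<delta>) * (c * geo_mean n / t powr lam) \<le> m \<and> m \<le> (1 + \<delta>) * (c * geo_mean n / t powr lam)"
      using A by (intro *) auto
  qed auto
qed

lemma balance_constant:
  fixes g :: "real \<Rightarrow> real"
  assumes "g \<in> O[at_top](\<lambda>t. t powr \<eta>)"
  obtains G where "G \<ge> 1" "\<forall>\<^sub>F t in at_top. g t \<le> G * t powr \<eta>"
proof -
  obtain K where K: "K > 0" "\<forall>\<^sub>F t in at_top. norm (g t) \<le> K * norm (t powr \<eta>)"
    using assms by (elim landau_o.bigE)
  have "\<forall>\<^sub>F t in at_top. g t \<le> max K 1 * t powr \<eta>"
    using K(2)
  proof eventually_elim
    case (elim t)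
    have "K * t powr \<eta> \<le> max K 1 * t powr \<eta>" by (intro mult_right_mono) auto
    then show ?case using elim by simp
  qed
  then show ?thesis using that[of "max K 1"] by simp
qed

text \<open>The remainder modulo \<open>q\<close> is dropped, so that all blocks have the same sizes
  and hence the same law.\<close>

definition consecutive_block :: "('d \<Rightarrow> nat) \<Rightarrow> nat \<Rightarrow> nat \<Rightarrow> 'd \<Rightarrow> nat set" where
  "consecutive_block n q k i = {k * (n i div q) + 1..Suc k * (n i div q)}"

lemma consecutive_block_subset:
  assumes "k < q"
  shows "consecutive_block n q k i \<subseteq> {1..n i}"
proof -
  have "Suc k * (n i div q) \<le> q * (n i div q)" using assms by (intro mult_right_mono) auto
  also have "\<dots> \<le> n i" by simp
  finally show ?thesis by (auto simp: consecutive_block_def)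
qed

lemma card_consecutive_block: "card (consecutive_block n q k i) = n i div q"
  by (simp add: consecutive_block_def)

lemma consecutive_block_less:
  assumes "k < l" "x \<in> consecutive_block n q k i" "y \<in> consecutive_block n q l i"
  shows "x < y"
proof -
  have "Suc k * (n i div q) \<le> l * (n i div q)" using assms by (intro mult_right_mono) auto
  moreover have "x \<le> Suc k * (n i div q)" "l * (n i div q) < y"
    using assms(2,3) by (auto simp: consecutive_block_def)
  ultimately show ?thesis by linarith
qed

section \<open>Lower bound\<close>

text \<open>The expectation bound is superadditivity with linearity of expectation, all blocks
  having the law \<open>F'\<close>. The tail bound compares \<open>L\<close> with its value on block
  0, which exists because \<open>q > 0\<close>.\<close>

lemma consecutive_blocks_bound:
  fixes n :: "'d::finite \<Rightarrow> nat"
  assumes supp: "set_pmf F \<subseteq> Pow (complete_hypergraph n)" and q: "q > 0"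
    and map: "\<And>k. k < q \<Longrightarrow> map_pmf (\<lambda>H. relabel (consecutive_block n q k) `
        induced (consecutive_block n q k) H) F = F'"
  shows "real q * measure_pmf.expectation F' (\<lambda>H. real (L H))
      \<le> measure_pmf.expectation F (\<lambda>H. real (L H))"
    and "measure_pmf.prob F {H. real (L H) \<le> x} \<le> measure_pmf.prob F' {H. real (L H) \<le> x}"
proof -
  let ?A = "consecutive_block n q"
  have fin: "finite (set_pmf F)" using finite_set_pmf_hypergraph[OF supp] .
  have finH: "finite H" if "H \<in> set_pmf F" for H
    using that supp finite_complete_hypergraph finite_subset by blast
  have finA: "finite (?A k i)" for k i by (simp add: consecutive_block_def)
  have "real q * measure_pmf.expectation F' (\<lambda>H. real (L H))
      = (\<Sum>k<q. measure_pmf.expectation F (\<lambda>H. real (L (induced (?A k) H))))"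
    using expectation_L_induced[OF map finA] by simp
  also have "\<dots> = measure_pmf.expectation F (\<lambda>H. \<Sum>k<q. real (L (induced (?A k) H)))"
    using fin by (simp add: integrable_measure_pmf_finite)
  also have "\<dots> \<le> measure_pmf.expectation F (\<lambda>H. real (L H))"
  proof (rule expectation_pmf_mono[OF fin])
    fix H assume "H \<in> set_pmf F"
    then have "(\<Sum>k<q. L (induced (?A k) H)) \<le> L H"
      using L_superadditive[OF finH, of H q ?A] consecutive_block_less by metis
    then show "(\<Sum>k<q. real (L (induced (?A k) H))) \<le> real (L H)"
      by (simp flip: of_nat_sum)
  qed
  finally show "real q * measure_pmf.expectation F' (\<lambda>H. real (L H))
      \<le> measure_pmf.expectation F (\<lambda>H. real (L H))" .
  have "measure_pmf.prob F {H. real (L H) \<le> x} \<le> measure_pmf.prob F {H. real (L (induced (?A 0) H)) \<le> x}"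
  proof (rule measure_pmf_mono, clarify)
    fix H assume "H \<in> set_pmf F" "real (L H) \<le> x"
    moreover have "L (induced (?A 0) H) \<le> L H"
      using finH \<open>H \<in> set_pmf F\<close> by (intro L_mono) (auto simp: induced_def)
    ultimately show "real (L (induced (?A 0) H)) \<le> x" by linarith
  qed
  also have "\<dots> = measure_pmf.prob F' {H. real (L H) \<le> x}"
    using prob_L_induced[OF map[OF q] finA, where P = "\<lambda>l. real l \<le> x"] by simp
  finally show "measure_pmf.prob F {H. real (L H) \<le> x} \<le> measure_pmf.prob F' {H. real (L H) \<le> x}" .
qed

text \<open>The hypotheses on \<open>C\<close> are what both kinds of model provide: the support,
  stability under division of the sizes, and the common law of consecutive blocks.\<close>

lemma lower_bound:
  fixes D :: "real \<Rightarrow> ('d::finite \<Rightarrow> nat) \<Rightarrow> ('d \<Rightarrow> nat) set pmf" and h c lam \<theta> \<eta> :: real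
  assumes h: "h > 0" and c: "c > 0" and lam: "lam \<ge> 0" and \<eta>: "0 \<le> \<eta>"
    and \<eta>_le: "CARD('d) \<ge> 2 \<Longrightarrow> \<eta> \<le> lam / (real CARD('d) - 1)"
    and gap: "\<eta> < \<theta> - lam" and g: "g \<in> O[at_top](\<lambda>t. t powr \<eta>)"
    and supp: "\<And>t n. n \<in> C \<Longrightarrow> set_pmf (D t n) \<subseteq> Pow (complete_hypergraph n)"
    and C: "\<And>n q. n \<in> C \<Longrightarrow> (\<lambda>i. n i div q) \<in> C"
    and map: "\<And>t n q k. n \<in> C \<Longrightarrow> k < q \<Longrightarrow> map_pmf (\<lambda>H. relabel (consecutive_block n q k) `
        induced (consecutive_block n q k) H) (D t n) = D t (\<lambda>i. n i div q)"
    and cc: "\<And>t n. n \<in> C \<Longrightarrow> concentration_constant (D t n) h"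
    and med: "approximate_median_on C D c lam \<theta>"
    and \<epsilon>: "0 < \<epsilon>" "\<epsilon> \<le> 1"
  shows "\<exists>t0 A. \<forall>t\<ge>t0. \<forall>n\<in>C. (\<forall>i. n i > 0) \<longrightarrow> geo_mean n \<ge> A * t powr lam \<longrightarrow>
      class_size_sum n \<le> g t * geo_mean n \<longrightarrow>
      (1 - \<epsilon>) * (c * geo_mean n / t powr lam) \<le> measure_pmf.expectation (D t n) (\<lambda>H. real (L H)) \<and>
      (\<forall>m. is_median_L (D t n) m \<longrightarrow> (1 - \<epsilon>) * (c * geo_mean n / t powr lam) \<le> m)"
proof -
  \<comment> \<open>Four factors \<open>1 - \<delta>\<close> are lost: rounding, the block median,
    the block expectation, and the return to a median of the whole graph. Bernoulli's inequality
    bounds their product below by \<open>1 - \<epsilon>\<close>.\<close>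
  define \<delta> where "\<delta> = \<epsilon> / 4"
  have \<delta>: "0 < \<delta>" "\<delta> \<le> 1 / 4" "\<delta> \<le> 1" using \<epsilon> by (auto simp: \<delta>_def)
  obtain a b t' where ab: "a \<ge> 1" "b \<ge> 1" and
    win: "\<forall>t n m. t \<ge> t' \<longrightarrow> n \<in> C \<longrightarrow> (\<forall>i. n i > 0) \<longrightarrow> geo_mean n \<ge> a * t powr lam \<longrightarrow>
       class_size_sum n * b \<le> t powr \<theta> \<longrightarrow> is_median_L (D t n) m \<longrightarrow>
       (1 - \<delta>) * (c * geo_mean n / t powr lam) \<le> m \<and> m \<le> (1 + \<delta>) * (c * geo_mean n / t powr lam)"
    using approximate_median_onE[OF med \<delta>(1)] .
  note win = win[rule_format]
  obtain G where G: "G \<ge> 1" and gG: "\<forall>\<^sub>F t in at_top. g t \<le> G * t powr \<eta>"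
    using balance_constant[OF g] .
  obtain R where R: "R \<ge> 1" and near: "\<forall>(F :: ('d \<Rightarrow> nat) set pmf) m.
     finite (set_pmf F) \<longrightarrow> concentration_constant F h \<longrightarrow> is_median_L F m \<longrightarrow> R \<le> m \<longrightarrow>
     (1 - \<delta>) * m \<le> measure_pmf.expectation F (\<lambda>H. real (L H)) \<and>
     measure_pmf.expectation F (\<lambda>H. real (L H)) \<le> (1 + \<delta>) * m"
    using expectation_near_median[OF h \<delta>(1) \<delta>(3), where ?'d = 'd] .
  note near = near[rule_format]
  \<comment> \<open>The first summand keeps every class at least \<open>q / \<delta>\<close>, the
    second puts the blocks above the lower end \<open>a * t powr lam\<close> of the median range,
    the third makes the block median at least \<open>2 * R + 16 / h\<close>.\<close>
  define M where "M = G ^ (CARD('d) - 1) / \<delta> + 2 * a + 4 * (2 * R + 16 / h) / c"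
  have pos: "G ^ (CARD('d) - 1) / \<delta> > 0" "2 * a \<ge> 2" "4 * (2 * R + 16 / h) / c > 0"
    using G \<delta> ab R h c by (auto intro!: divide_pos_pos add_pos_pos)
  have M: "M \<ge> G ^ (CARD('d) - 1) / \<delta>" "M \<ge> 2 * a" "M \<ge> 4 * (2 * R + 16 / h) / c" "M > 0"
    using pos unfolding M_def by linarith+
  have "\<forall>\<^sub>F t in at_top. t \<ge> 1 \<and> t \<ge> t' \<and> g t \<le> G * t powr \<eta> \<and>
      (2 * b * G * M) * t powr (\<eta> + lam) \<le> t powr \<theta>"
    using gap by (intro eventually_conj eventually_ge_at_top gG eventually_powr_dominates) simp
  then obtain t0 where t0: "\<And>t. t \<ge> t0 \<Longrightarrow> t \<ge> 1 \<and> t \<ge> t' \<and> g t \<le> G * t powr \<eta> \<and>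
      (2 * b * G * M) * t powr (\<eta> + lam) \<le> t powr \<theta>"
    by (auto simp: eventually_at_top_linorder)
  show ?thesis
  proof (rule exI[of _ t0], rule exI[of _ M], intro allI impI ballI)
    fix t n
    assume t: "t \<ge> t0" and nC: "n \<in> C" and n: "\<forall>i. n i > 0" and NM: "geo_mean n \<ge> M * t powr lam"
      and S: "class_size_sum n \<le> g t * geo_mean n"
    define N where "N = geo_mean n"
    define Z where "Z = t powr lam"
    define \<gamma> where "\<gamma> = G * t powr \<eta>"
    define \<mu> where "\<mu> = c * N / Z"
    note t0 = t0[OF t]
    have Z: "Z \<ge> 1" unfolding Z_def using t0 lam by (simp add: ge_one_powr_ge_zero)
    have N: "N > 0" unfolding N_def using n geo_mean_pos by blast
    have "g t * N \<le> \<gamma> * N" using t0 N by (intro mult_right_mono) (auto simp: \<gamma>_def)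
    then have S\<gamma>: "class_size_sum n \<le> \<gamma> * N" using S by (simp add: N_def)
    have \<gamma>: "\<gamma> \<ge> 0" using G by (simp add: \<gamma>_def)
    \<comment> \<open>Here the bound of \<open>\<eta>\<close> by \<open>lam / (d - 1)\<close>
      enters; for a single class the exponent is 0.\<close>
    have \<gamma>pow: "\<gamma> ^ (CARD('d) - 1) \<le> G ^ (CARD('d) - 1) * Z"
    proof -
      have "(t powr \<eta>) ^ (CARD('d) - 1) = t powr (\<eta> * real (CARD('d) - 1))"
        using t0 by (simp add: powr_powr flip: powr_realpow)
      also have "\<eta> * real (CARD('d) - 1) \<le> lam"
      proof (cases "CARD('d) \<ge> 2")
        case True
        then have "real (CARD('d) - 1) = real CARD('d) - 1" "real CARD('d) - 1 > 0" by (auto simp: of_nat_diff)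
        then show ?thesis using \<eta>_le[OF True] by (simp add: field_simps)
      next
        case False
        then have "CARD('d) - 1 = 0" by simp
        then show ?thesis using lam by (metis mult_zero_right of_nat_0)
      qed
      then have "t powr (\<eta> * real (CARD('d) - 1)) \<le> Z" unfolding Z_def using t0 by (intro powr_mono) auto
      finally show ?thesis using G by (simp add: \<gamma>_def power_mult_distrib mult_left_mono)
    qed
    \<comment> \<open>\<open>y\<close> is the number of pieces of geometric mean
      \<open>M * Z\<close> that fit into \<open>N\<close>; as \<open>y \<ge> 1\<close>, rounding
      down to \<open>q\<close> loses at most a factor 2.\<close>
    define y where "y = N / (M * Z)"
    have MZ: "M * Z > 0" using M Z by simp
    have y: "y \<ge> 1" using NM MZ by (simp add: y_def N_def Z_def le_divide_eq_1_pos)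
    define q where "q = nat \<lfloor>y\<rfloor>"
    have q: "q \<ge> 1" "real q \<le> y" using y unfolding q_def by linarith+
    have "y \<le> real q + 1" using y unfolding q_def by linarith
    then have q2: "y \<le> 2 * real q" using q(1) by simp
    have qMZ: "real q * (M * Z) \<le> N" "N \<le> 2 * real q * (M * Z)"
      using q(2) q2 MZ by (simp_all add: y_def pos_le_divide_eq pos_divide_le_eq)
    define w where "w = (\<lambda>i. n i div q)"
    \<comment> \<open>By balance even the smallest class has \<open>q / \<delta>\<close> vertices,
      so replacing \<open>n i / q\<close> by its floor costs at most the factor
      \<open>1 - \<delta>\<close>.\<close>
    have q\<delta>: "real q \<le> \<delta> * real (n i)" for i
    proof -
      have "real q * (M * Z) \<le> real (n i) * \<gamma> ^ (CARD('d) - 1)"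
        using geo_mean_le_class_size[of n \<gamma> i] n S\<gamma> qMZ(1) by (auto simp: N_def)
      also have "\<dots> \<le> real (n i) * (G ^ (CARD('d) - 1) * Z)"
        using \<gamma>pow by (intro mult_left_mono) auto
      also have "\<dots> \<le> real (n i) * ((\<delta> * M) * Z)"
        using M(1) \<delta> Z by (intro mult_left_mono mult_right_mono) (auto simp: field_simps)
      finally have "real q * (M * Z) \<le> (\<delta> * real (n i)) * (M * Z)" by (simp add: mult_ac)
      then show ?thesis using M Z by (simp add: mult_le_cancel_right_pos)
    qed
    have w_ge: "(1 - \<delta>) / real q * real (n i) \<le> real (w i)" for i
    proof -
      have "real (n i) / real q - 1 \<le> real (w i)"
      proof -
        have "n i \<le> q * (n i div q) + q"
          using q(1) by (metis mult_div_mod_eq add_left_mono less_imp_le mod_less_divisor zero_less_one order_less_le_trans)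
        then have "real (n i) \<le> real q * real (w i) + real q"
          unfolding w_def by (metis of_nat_add of_nat_le_iff of_nat_mult)
        then show ?thesis using q(1) by (simp add: field_simps)
      qed
      moreover have "1 \<le> \<delta> * real (n i) / real q" using q\<delta>[of i] q(1) by (simp add: field_simps)
      ultimately show ?thesis by (simp add: algebra_simps diff_divide_distrib)
    qed
    have w_pos: "w i > 0" for i
    proof -
      have "0 < (1 - \<delta>) / real q * real (n i)" using \<delta> q(1) n by (intro mult_pos_pos divide_pos_pos) auto
      then show ?thesis using w_ge[of i] by simp
    qed
    have Nw: "(1 - \<delta>) / real q * N \<le> geo_mean w"
      unfolding N_def using w_ge \<delta> by (intro geo_mean_ge) auto
    have Nq: "M * Z \<le> N / real q" "N / real q \<le> 2 * (M * Z)"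
      using qMZ q(1) by (simp_all add: field_simps)
    have big: "a * Z \<le> geo_mean w"
    proof -
      have "a * Z \<le> (1 - \<delta>) * (2 * a) * Z"
        using \<delta> ab Z mult_right_mono[of "1/2" "1 - \<delta>" "2 * a"] by (intro mult_right_mono) auto
      also have "\<dots> \<le> (1 - \<delta>) * M * Z" using \<delta> M Z by (intro mult_right_mono mult_left_mono) auto
      also have "\<dots> = (1 - \<delta>) * (M * Z)" by simp
      also have "\<dots> \<le> (1 - \<delta>) * (N / real q)" using Nq \<delta> by (intro mult_left_mono) auto
      finally show ?thesis using Nw by simp
    qed
    \<comment> \<open>Cutting into \<open>q\<close> blocks brings the sum of the sizes down to order
      \<open>t powr (\<eta> + lam)\<close>, which the gap keeps below
      \<open>t powr \<theta>\<close>, even if the sum for \<open>n\<close> itself is far beyond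
      it.\<close>
    have small: "class_size_sum w * b \<le> t powr \<theta>"
    proof -
      have "class_size_sum w \<le> (\<Sum>i\<in>UNIV. real (n i) / real q)"
        unfolding class_size_sum_def w_def by (intro sum_mono of_nat_div_le_of_nat)
      also have "\<dots> = class_size_sum n / real q"
        by (simp add: class_size_sum_def sum_divide_distrib)
      also have "\<dots> \<le> \<gamma> * N / real q" using S\<gamma> by (intro divide_right_mono) auto
      also have "\<dots> = \<gamma> * (N / real q)" by simp
      also have "\<dots> \<le> \<gamma> * (2 * (M * Z))" using Nq \<gamma> by (intro mult_left_mono) auto
      finally have "class_size_sum w * b \<le> \<gamma> * (2 * (M * Z)) * b"
        using ab by (intro mult_right_mono) auto
      also have "\<dots> = (2 * b * G * M) * t powr (\<eta> + lam)"
        by (simp add: \<gamma>_def Z_def powr_add)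
      finally show ?thesis using t0 by linarith
    qed
    have wC: "w \<in> C" unfolding w_def using C nC by blast
    have finw: "finite (set_pmf (D t w))" using finite_set_pmf_hypergraph[OF supp[OF wC]] .
    have finn: "finite (set_pmf (D t n))" using finite_set_pmf_hypergraph[OF supp[OF nC]] .
    obtain m' where m': "is_median_L (D t w) m'" using median_exists[OF finw] .
    have "(1 - \<delta>) * (c * geo_mean w / Z) \<le> m'"
      using win[of t w m'] t0 wC w_pos big small m' by (auto simp: Z_def)
    moreover have "(1 - \<delta>) * (c * ((1 - \<delta>) / real q * N) / Z) \<le> (1 - \<delta>) * (c * geo_mean w / Z)"
      using Nw \<delta> c Z by (intro mult_left_mono divide_right_mono) auto
    ultimately have m'_ge: "(1 - \<delta>)\<^sup>2 * \<mu> / real q \<le> m'"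
      by (simp add: \<mu>_def power2_eq_square mult_ac)
    have "4 * (2 * R + 16 / h) \<le> M * c" using M(3) c by (simp add: field_simps)
    also have "M \<le> N / real q / Z" using Nq(1) Z by (subst pos_le_divide_eq) auto
    then have "M * c \<le> N / real q / Z * c" using c by (intro mult_right_mono) auto
    also have "\<dots> = \<mu> / real q" by (simp add: \<mu>_def mult_ac)
    finally have "(1 / 4) * (4 * (2 * R + 16 / h)) \<le> (1 / 4) * (\<mu> / real q)" by simp
    also have "\<dots> \<le> (1 - \<delta>)\<^sup>2 * (\<mu> / real q)"
    proof (rule mult_right_mono)
      have "(1/2::real)\<^sup>2 \<le> (1 - \<delta>)\<^sup>2" using \<delta> by (intro power_mono) auto
      then show "1 / 4 \<le> (1 - \<delta>)\<^sup>2" by (simp add: power2_eq_square)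
    qed (use c N Z in \<open>simp add: \<mu>_def\<close>)
    also have "\<dots> \<le> m'" using m'_ge by simp
    finally have *: "1 / 4 * (4 * (2 * R + 16 / h)) \<le> m'" .
    have quarter: "1 / 4 * (4 * x) = x" for x :: real by simp
    from * have m'R: "2 * R + 16 / h \<le> m'" unfolding quarter .
    have h16: "16 / h > 0" using h by simp
    have m'2R: "2 * R \<le> m'" and m'h: "16 / h \<le> m'" using m'R h16 R by linarith+
    let ?E = "\<lambda>v. measure_pmf.expectation (D t v) (\<lambda>H. real (L H))"
    have Ew: "(1 - \<delta>) * m' \<le> ?E w"
      using near[OF finw cc[OF wC] m'] m'R R h16 by linarith
    have mp: "\<And>k. k < q \<Longrightarrow> map_pmf (\<lambda>H. relabel (consecutive_block n q k) `
        induced (consecutive_block n q k) H) (D t n) = D t w"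
      unfolding w_def using map nC by blast
    have "0 < q" using q(1) by simp
    note cb = consecutive_blocks_bound[OF supp[OF nC] this mp]
    have En: "(1 - \<delta>) ^ 3 * \<mu> \<le> ?E n"
    proof -
      have "(1 - \<delta>) ^ 3 * \<mu> = real q * ((1 - \<delta>) * ((1 - \<delta>)\<^sup>2 * \<mu> / real q))"
        using q(1) by (simp add: power3_eq_cube power2_eq_square)
      also have "\<dots> \<le> real q * ((1 - \<delta>) * m')" using m'_ge \<delta> by (intro mult_left_mono) auto
      also have "\<dots> \<le> real q * ?E w" using Ew by (intro mult_left_mono) auto
      also have "\<dots> \<le> ?E n" by (rule cb(1))
      finally show ?thesis .
    qed
    have \<mu>: "\<mu> \<ge> 0" using c N Z by (simp add: \<mu>_def)
    have bern: "1 - \<epsilon> \<le> (1 - \<delta>) ^ 4"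
      using Bernoulli_inequality[of "- \<delta>" 4] \<delta> by (simp add: \<delta>_def)
    have "(1 - \<epsilon>) * \<mu> \<le> (1 - \<delta>) ^ 4 * \<mu>" using bern \<mu> by (rule mult_right_mono)
    also have "\<dots> \<le> (1 - \<delta>) ^ 3 * \<mu>" using \<delta> \<mu> by (intro mult_right_mono power_decreasing) auto
    also note En
    finally have E_final: "(1 - \<epsilon>) * \<mu> \<le> ?E n" .
    have med_final: "(1 - \<epsilon>) * \<mu> \<le> m" if m: "is_median_L (D t n) m" for m
    proof -
      \<comment> \<open>A median below \<open>R\<close> would give \<open>L \<le> R\<close>
        probability at least 1/2 on a single block. But \<open>m' \<ge> 2 * R\<close>, and with
        \<open>m' \<ge> 16 / h\<close> and \<open>exp 4 \<ge> 5\<close> concentration on the block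
        bounds this probability by 2/5.\<close>
      have "R \<le> m"
      proof (rule ccontr)
        assume "\<not> R \<le> m"
        have "16 \<le> h * m'" using m'h h by (simp add: field_simps)
        then have e: "5 \<le> exp (h * m' / 4)" using exp_ge_add_one_self[of "h * m' / 4"] by linarith
        have "1 / 2 \<le> measure_pmf.prob (D t n) {H. real (L H) \<le> m}"
          using m by (simp add: is_median_L_def)
        also have "\<dots> \<le> measure_pmf.prob (D t n) {H. real (L H) \<le> R}"
          using \<open>\<not> R \<le> m\<close> by (intro measure_pmf_mono) auto
        also have "\<dots> \<le> measure_pmf.prob (D t w) {H. real (L H) \<le> R}" by (rule cb(2))
        also have "\<dots> \<le> measure_pmf.prob (D t w) {H. real (L H) \<le> (1 - 1/2) * m'}"
        proof (rule measure_pmf_mono)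
          fix H assume "H \<in> {H. real (L H) \<le> R}"
          then show "H \<in> {H. real (L H) \<le> (1 - 1/2) * m'}" using m'2R by simp
        qed
        also have "\<dots> \<le> 2 * exp (- h * (1/2)\<^sup>2 * m')"
          by (rule lower_tailD[OF cc[OF wC] m']) simp
        also have "\<dots> = 2 / exp (h * m' / 4)" by (simp add: power2_eq_square exp_minus field_simps)
        also have "\<dots> \<le> 2 / 5" using e by (intro divide_left_mono) auto
        finally show False by simp
      qed
      \<comment> \<open>Concentration of the whole graph turns the bound on the expectation into one
        on \<open>m\<close>, at the cost of a factor \<open>1 - \<delta>\<close>, since
        \<open>(1 - \<delta>) * (1 + \<delta>) \<le> 1\<close>.\<close>
      then have "?E n \<le> (1 + \<delta>) * m" using near[OF finn cc[OF nC] m] by blast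
      then have "(1 - \<delta>) * ((1 - \<delta>) ^ 3 * \<mu>) \<le> (1 - \<delta>) * ((1 + \<delta>) * m)"
        using En \<delta> by (intro mult_left_mono) auto
      also have "\<dots> \<le> 1 * m"
        using \<open>R \<le> m\<close> R unfolding mult.assoc[symmetric]
        by (intro mult_right_mono) (auto simp: algebra_simps)
      finally have "(1 - \<delta>) ^ 4 * \<mu> \<le> m" by (simp add: eval_nat_numeral mult_ac)
      then show ?thesis using mult_right_mono[OF bern \<mu>] by linarith
    qed
    show "(1 - \<epsilon>) * (c * geo_mean n / t powr lam) \<le> ?E n \<and>
      (\<forall>m. is_median_L (D t n) m \<longrightarrow> (1 - \<epsilon>) * (c * geo_mean n / t powr lam) \<le> m)"
      using E_final med_final unfolding \<mu>_def N_def Z_def by blast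
  qed
qed

section \<open>Upper bound\<close>

text \<open>Combines \<open>(n choose q) * fact q \<le> n ^ q\<close> with
  \<open>q ^ q / fact q \<le> exp 1 ^ q\<close>, whose left side is a single term of the exponential
  series.\<close>

lemma binomial_le_exp_power:
  assumes q: "q > 0"
  shows "real (n choose q) \<le> (exp 1 * real n / real q) ^ q"
proof (cases "q \<le> n")
  case True
  have "(n choose q) * fact q * fact (n - q) = fact n"
    using binomial_fact_lemma[OF True] by (simp add: mult_ac)
  then have "(n choose q) * fact q = fact n div fact (n - q)"
    by (metis fact_nonzero nonzero_mult_div_cancel_right)
  also have "\<dots> \<le> n ^ q" using True by (rule fact_div_fact_le_pow)
  finally have "real ((n choose q) * fact q) \<le> real (n ^ q)" by (rule of_nat_mono)
  then have 1: "real (n choose q) * fact q \<le> real n ^ q" by simp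
  have "(\<Sum>k\<in>{q}. real q ^ k /\<^sub>R fact k) \<le> (\<Sum>k. real q ^ k /\<^sub>R fact k)"
    by (intro sum_le_suminf summable_exp_generic) auto
  then have 2: "real q ^ q / fact q \<le> exp 1 ^ q"
    using exp_of_nat_mult[of q "1::real"] fun_cong[OF exp_def, of "real q"]
    by (simp add: divide_inverse mult.commute)
  have "real (n choose q) * real q ^ q = (real (n choose q) * fact q) * (real q ^ q / fact q)" by simp
  also have "\<dots> \<le> real n ^ q * exp 1 ^ q"
    using 1 2 by (intro mult_mono) auto
  finally show ?thesis using q by (simp add: power_divide power_mult_distrib field_simps)
qed (simp add: binomial_eq_0)

text \<open>Markov's inequality for the counting measure on \<open>J\<close>.\<close>

lemma card_large_le:
  fixes f :: "'b \<Rightarrow> real"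
  assumes "finite J" "\<And>j. j \<in> J \<Longrightarrow> 0 \<le> f j" "(\<Sum>j\<in>J. f j) \<le> X"
  shows "real (card {j \<in> J. x < f j}) * x \<le> X"
proof -
  have "real (card {j \<in> J. x < f j}) * x = (\<Sum>j\<in>{j \<in> J. x < f j}. x)" by simp
  also have "\<dots> \<le> (\<Sum>j\<in>{j \<in> J. x < f j}. f j)" by (intro sum_mono) auto
  also have "\<dots> \<le> (\<Sum>j\<in>J. f j)" using assms by (intro sum_mono2) auto
  finally show ?thesis using assms(3) by simp
qed

lemma sum_card_cut_block_le: "(\<Sum>j<q. card (cut_block n V j i)) \<le> n i"
proof -
  have "(\<Sum>j<q. card (cut_block n V j i)) = card (\<Union>j<q. cut_block n V j i)"
    by (subst card_UN_disjoint) (auto simp: cut_block_def)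
  also have "\<dots> \<le> card {1..n i}" by (intro card_mono) (auto simp: cut_block_def)
  finally show ?thesis by simp
qed

text \<open>Union bound over all choices of \<open>q\<close> cut points in each class, the binomials
  counting these choices; for a fixed choice the blocks are independent, so the probability is the
  product bounded by \<open>x\<close>.\<close>

lemma union_bound_cut_blocks:
  fixes F :: "('d::finite \<Rightarrow> nat) \<Rightarrow> ('d \<Rightarrow> nat) set pmf"
  assumes model: "random_hypergraph_model F" and r: "r > 0"
    and x: "\<And>V. (\<And>i. V i \<subseteq> {1..n i}) \<Longrightarrow> (\<And>i. card (V i) = q) \<Longrightarrow>
      (\<Prod>j<q. measure_pmf.prob (F (\<lambda>i. card (cut_block n V j i))) {H. r \<le> L H}) \<le> x"
  shows "measure_pmf.prob (F n) {H. q * r \<le> L H} \<le> (\<Prod>i\<in>UNIV. real (n i choose q)) * x"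
proof -
  define Vs where "Vs = (\<Pi>\<^sub>E i\<in>UNIV. {W. W \<subseteq> {1..n i} \<and> card W = q})"
  define E where "E V = {H. \<forall>j<q. r \<le> L (induced (cut_block n V j) H)}" for V
  have finVs: "finite Vs" unfolding Vs_def by (intro finite_PiE) auto
  have cardVs: "real (card Vs) = (\<Prod>i\<in>UNIV. real (n i choose q))"
    unfolding Vs_def by (simp add: card_PiE n_subsets)
  have "measure_pmf.prob (F n) {H. q * r \<le> L H} \<le> measure_pmf.prob (F n) (\<Union>V\<in>Vs. E V)"
  proof (rule measure_pmf_mono)
    fix H assume H: "H \<in> set_pmf (F n)" "H \<in> {H. q * r \<le> L H}"
    then have sub: "H \<subseteq> complete_hypergraph n" using model_support[OF model] by blast
    then have "finite H" using finite_complete_hypergraph finite_subset by blast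
    then obtain V where "\<And>i. V i \<subseteq> {1..n i}" "\<And>i. card (V i) = q"
      "\<And>j. j < q \<Longrightarrow> r \<le> L (induced (cut_block n V j) H)"
      using L_ge_imp_blocks[OF _ sub r, of q] H(2) by auto
    then show "H \<in> (\<Union>V\<in>Vs. E V)" by (auto simp: Vs_def E_def)
  qed
  also have "\<dots> \<le> (\<Sum>V\<in>Vs. measure_pmf.prob (F n) (E V))"
    by (intro measure_pmf.finite_measure_subadditive_finite finVs) auto
  also have "\<dots> \<le> (\<Sum>V\<in>Vs. x)"
  proof (rule sum_mono)
    fix V assume "V \<in> Vs"
    then have V: "\<And>i. V i \<subseteq> {1..n i}" "\<And>i. card (V i) = q" by (auto simp: Vs_def PiE_def Pi_def)
    have "measure_pmf.prob (F n) (E V)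
        = (\<Prod>j<q. measure_pmf.prob (F (\<lambda>i. card (cut_block n V j i))) {H. r \<le> L H})"
      unfolding E_def by (rule prob_blocks_indep[OF model]) (auto simp: cut_block_def)
    then show "measure_pmf.prob (F n) (E V) \<le> x" using x[OF V] by simp
  qed
  finally show ?thesis by (simp add: cardVs)
qed

text \<open>If the geometric mean of the sizes is below the range of the median hypothesis, the sizes are
  raised to a common floor \<open>k\<close>, the least one that reaches that range. Raising \<open>k\<close> by one at most
  doubles the geometric mean, so it stays of order \<open>a * Z\<close>.\<close>

lemma block_upper_tail:
  fixes F :: "('d::finite \<Rightarrow> nat) \<Rightarrow> ('d \<Rightarrow> nat) set pmf"
  assumes model: "random_hypergraph_model F" and cc: "\<And>n. concentration_constant (F n) h"
    and h: "h > 0" and c: "c > 0" and a: "a \<ge> 1" and b: "b \<ge> 1" and Z: "Z \<ge> 1"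
    and \<delta>: "0 < \<delta>" "\<delta> < 1" and \<sigma>: "\<sigma> > 0"
    and win: "\<And>n m. \<forall>i. n i > 0 \<Longrightarrow> a * Z \<le> geo_mean n \<Longrightarrow> class_size_sum n * b \<le> T \<Longrightarrow>
      is_median_L (F n) m \<Longrightarrow> (1 - \<delta>) * (c * geo_mean n / Z) \<le> m \<and> m \<le> (1 + \<delta>) * (c * geo_mean n / Z)"
    and n: "\<And>i. n i > 0"
    and r: "(1 + \<sigma>) * (1 + \<delta>) * (c * geo_mean n / Z) \<le> real r" "(1 + \<sigma>) * (1 + \<delta>) * (2 * a * c) \<le> real r"
    and S: "(class_size_sum n + real CARD('d) * (a * Z + 1)) * b \<le> T"
  shows "measure_pmf.prob (F n) {H. r \<le> L H} \<le> 2 * exp (- (h * (\<sigma> / (1 + \<sigma>))\<^sup>2 * real r))"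
proof -
  define v where "v k = (\<lambda>i. max (n i) k)" for k
  have v_ge: "real k \<le> geo_mean (v k)" for k
    using geo_mean_ge[of "real k" "\<lambda>_. 1" "v k"] by (simp add: v_def geo_mean_const)
  define k where "k = (LEAST k. 1 \<le> k \<and> a * Z \<le> geo_mean (v k))"
  have aZ: "a * Z \<ge> 1" using mult_mono[OF a Z] a Z by simp
  have "1 \<le> nat \<lceil>a * Z\<rceil> \<and> a * Z \<le> geo_mean (v (nat \<lceil>a * Z\<rceil>))"
  proof
    show "1 \<le> nat \<lceil>a * Z\<rceil>" using aZ by linarith
    show "a * Z \<le> geo_mean (v (nat \<lceil>a * Z\<rceil>))"
      using v_ge[of "nat \<lceil>a * Z\<rceil>"] by linarith
  qed
  then have k: "1 \<le> k" "a * Z \<le> geo_mean (v k)"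
    unfolding k_def by (metis (mono_tags, lifting) LeastI)+
  have vpos: "v k i > 0" for i using n[of i] by (simp add: v_def)
  have r_v: "(1 + \<sigma>) * (1 + \<delta>) * (c * geo_mean (v k) / Z) \<le> real r" and
    S_v: "class_size_sum (v k) * b \<le> T"
  proof -
    have "(1 + \<sigma>) * (1 + \<delta>) * (c * geo_mean (v k) / Z) \<le> real r \<and>
      class_size_sum (v k) \<le> class_size_sum n + real CARD('d) * (a * Z + 1)"
    proof (cases "k = 1")
      \<comment> \<open>Floor 1 leaves positive sizes unchanged; this is the case of sizes that
        already reach the range.\<close>
      case True
      have "v k i = n i" for i unfolding v_def True using n[of i] by auto
      then have vn: "v k = n" by blast
      have "0 \<le> real CARD('d) * (a * Z + 1)" using aZ by simp
      then show ?thesis using r vn by simp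
    next
      case False
      then obtain j where j: "k = Suc j" "j \<ge> 1" using k(1) by (cases k) auto
      then have "\<not> (1 \<le> j \<and> a * Z \<le> geo_mean (v j))"
        unfolding k_def by (metis (mono_tags, lifting) lessI not_less_Least)
      then have lt: "geo_mean (v j) < a * Z" using j by simp
      have "geo_mean (v k) \<le> 2 * geo_mean (v j)"
        using j by (intro geo_mean_le) (auto simp: v_def)
      then have "geo_mean (v k) / Z \<le> 2 * a" using lt Z by (simp add: pos_divide_le_eq)
      then have "c * (geo_mean (v k) / Z) \<le> c * (2 * a)" using c by (intro mult_left_mono) auto
      then have "(1 + \<sigma>) * (1 + \<delta>) * (c * geo_mean (v k) / Z) \<le> (1 + \<sigma>) * (1 + \<delta>) * (2 * a * c)"
        using \<sigma> \<delta> by (intro mult_left_mono) (auto simp: mult_ac)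
      moreover have "class_size_sum (v k) \<le> class_size_sum n + real CARD('d) * (a * Z + 1)"
      proof -
        \<comment> \<open>As \<open>j \<le> geo_mean (v j) < a * Z\<close>, the floor adds at most
          \<open>a * Z + 1\<close> to each class.\<close>
        have "real k \<le> a * Z + 1" using v_ge[of j] lt j by simp
        then have "class_size_sum (v k) \<le> (\<Sum>i\<in>UNIV. real (n i) + (a * Z + 1))"
          unfolding class_size_sum_def v_def by (intro sum_mono) auto
        also have "\<dots> = class_size_sum n + real CARD('d) * (a * Z + 1)"
          by (simp add: sum.distrib class_size_sum_def)
        finally show ?thesis .
      qed
      ultimately show ?thesis using r by linarith
    qed
    then have 1: "(1 + \<sigma>) * (1 + \<delta>) * (c * geo_mean (v k) / Z) \<le> real r"
      and 2: "class_size_sum (v k) \<le> class_size_sum n + real CARD('d) * (a * Z + 1)" by blast+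
    show "(1 + \<sigma>) * (1 + \<delta>) * (c * geo_mean (v k) / Z) \<le> real r" by (rule 1)
    show "class_size_sum (v k) * b \<le> T" using mult_right_mono[OF 2, of b] b S by linarith
  qed
  obtain m where m: "is_median_L (F (v k)) m"
    using median_exists finite_set_pmf_hypergraph[OF model_support[OF model]] by blast
  have mw: "(1 - \<delta>) * (c * geo_mean (v k) / Z) \<le> m" "m \<le> (1 + \<delta>) * (c * geo_mean (v k) / Z)"
    using win[OF _ k(2) S_v m] vpos by auto
  have "0 < (1 - \<delta>) * (c * geo_mean (v k) / Z)"
    using \<delta> c Z geo_mean_pos[OF vpos] by (intro mult_pos_pos divide_pos_pos) auto
  then have mpos: "0 < m" using mw by linarith
  have "(1 + \<sigma>) * m \<le> (1 + \<sigma>) * ((1 + \<delta>) * (c * geo_mean (v k) / Z))"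
    using mw \<sigma> by (intro mult_left_mono) auto
  then have "(1 + \<sigma>) * m \<le> real r" using r_v by simp
  then have "measure_pmf.prob (F (v k)) {H. real r \<le> real (L H)}
      \<le> 2 * exp (- (h * (\<sigma> / (1 + \<sigma>))\<^sup>2 * real r))"
    using h \<sigma> by (intro upper_tail_far[OF cc m mpos]) auto
  moreover have "n \<le> v k" by (simp add: v_def le_fun_def)
  ultimately show ?thesis using upper_tail_mono[OF model, of n "v k" r] by simp
qed

text \<open>\<open>X\<close>, \<open>Y\<close>, \<open>Z\<close>, \<open>T\<close> stand for powers
  of \<open>t\<close> with exponents \<open>\<tau>\<close>, \<open>\<eta>\<close>,
  \<open>lam\<close>, \<open>\<theta>\<close>. \<open>c1\<close> makes \<open>r\<close> large enough
  for blocks raised to the floor, \<open>c2\<close> keeps good blocks in the median range,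
  \<open>c3\<close> makes \<open>\<mu> / r\<close> at least \<open>4 / \<epsilon>\<close>,
  \<open>c4\<close> makes the tail bound at most 1, and \<open>c5\<close> lets the tails beat the
  number of cuts.\<close>

lemma upper_tail_half:
  fixes F :: "('d::finite \<Rightarrow> nat) \<Rightarrow> ('d \<Rightarrow> nat) set pmf"
  assumes model: "random_hypergraph_model F" and cc: "\<And>n. concentration_constant (F n) h"
    and h: "h > 0" and c: "c > 0" and \<epsilon>: "0 < \<epsilon>" "\<epsilon> \<le> 1"
    and a: "a \<ge> 1" and b: "b \<ge> 1" and G: "G \<ge> 1" and X: "X \<ge> 1" and Y: "Y \<ge> 1" and Z: "Z \<ge> 1"
    and win: "\<And>n m. \<forall>i. n i > 0 \<Longrightarrow> a * Z \<le> geo_mean n \<Longrightarrow> class_size_sum n * b \<le> T \<Longrightarrow>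
      is_median_L (F n) m \<Longrightarrow>
      (1 - \<epsilon> / 16) * (c * geo_mean n / Z) \<le> m \<and> m \<le> (1 + \<epsilon> / 16) * (c * geo_mean n / Z)"
    and T: "T = X ^ 4 * Z * Y" and \<kappa>: "\<kappa> = h * ((\<epsilon> / 8) / (1 + \<epsilon> / 8))\<^sup>2"
    and c1: "(1 + \<epsilon> / 8) * (1 + \<epsilon> / 16) * (2 * a * c) \<le> X"
    and c2: "b * (8 * G / (\<epsilon> * c) + real CARD('d) * (a + 1)) * (Y * Z * X) \<le> T"
    and c3: "8 * b * G / (\<epsilon> * c) * X \<le> X ^ 4"
    and c4: "2 * exp (- (\<kappa> * X)) \<le> 1"
    and c5: "(6 * G / c * (Y * Z * X)) ^ CARD('d) * (2 * exp (- (\<kappa> * X))) powr (\<epsilon> / 8) < 1 / 2"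
    and n: "\<And>i. n i > 0" and S: "class_size_sum n \<le> G * Y * geo_mean n" and large: "class_size_sum n * b > T"
  shows "measure_pmf.prob (F n) {H. (1 + \<epsilon>) * (c * geo_mean n / Z) \<le> real (L H)} < 1 / 2"
proof -
  define N where "N = geo_mean n"
  define \<mu> where "\<mu> = c * N / Z"
  define r where "r = nat \<lceil>X\<rceil>"
  have N: "N > 0" unfolding N_def using n geo_mean_pos by blast
  have r: "X \<le> real r" "real r \<le> 2 * X" "r > 0" using X unfolding r_def by linarith+
  have \<kappa>0: "\<kappa> > 0" using h \<epsilon> unfolding \<kappa> by (intro mult_pos_pos zero_less_power divide_pos_pos) auto
  \<comment> \<open>\<open>large\<close> and the balance condition bound \<open>N\<close> from
    below, and \<open>c3\<close> converts this into a bound on \<open>\<mu>\<close>.\<close>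
  have \<mu>: "8 / \<epsilon> * X \<le> \<mu>"
  proof -
    have "X ^ 4 * Z * Y < (G * Y * N) * b"
      using large mult_right_mono[OF S, of b] b unfolding T N_def by linarith
    then have "(X ^ 4 * Z) * Y < (G * N * b) * Y" by (simp add: mult_ac)
    then have "X ^ 4 * Z < G * N * b" using Y by (simp add: mult_less_cancel_right_pos)
    then have "8 * b * G / (\<epsilon> * c) * X * Z < G * N * b"
      using mult_right_mono[OF c3, of Z] Z by linarith
    then have "(b * G) * (8 * X * Z) < (b * G) * (N * (\<epsilon> * c))"
      using \<epsilon> c by (simp add: field_simps)
    then have "8 * X * Z < N * (\<epsilon> * c)" using b G by (simp add: mult_less_cancel_left_pos)
    then show ?thesis using \<epsilon> Z by (simp add: \<mu>_def field_simps)
  qed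
  \<comment> \<open>\<open>y\<close> is the number of groups of \<open>r\<close> edges in a matching
    of size \<open>\<mu>\<close>. As \<open>y \<ge> 4 / \<epsilon>\<close>, taking the floor of
    \<open>(1 + \<epsilon>) * y\<close> costs at most \<open>\<epsilon> / 4 * y\<close>.\<close>
  define y where "y = \<mu> / real r"
  have y: "4 / \<epsilon> \<le> y"
  proof -
    have "4 / \<epsilon> * real r \<le> 4 / \<epsilon> * (2 * X)" using r \<epsilon> by (intro mult_left_mono) auto
    then show ?thesis using \<mu> r by (simp add: y_def pos_le_divide_eq)
  qed
  have y\<epsilon>: "1 \<le> \<epsilon> / 4 * y" using y \<epsilon> by (simp add: field_simps)
  have y4: "4 \<le> y" 
  proof -
    have "4 \<le> 4 / \<epsilon>" using \<epsilon> by (simp add: field_simps)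
    then show ?thesis using y by linarith
  qed
  define q where "q = nat \<lfloor>(1 + \<epsilon>) * y\<rfloor>"
  have "0 \<le> (1 + \<epsilon>) * y" using \<epsilon> y4 by simp
  then have q: "real q \<le> (1 + \<epsilon>) * y" "(1 + \<epsilon>) * y - 1 \<le> real q" unfolding q_def by linarith+
  have q_ge: "(1 + 3 * \<epsilon> / 4) * y \<le> real q" using q(2) y\<epsilon> by (simp add: algebra_simps)
  have "0 \<le> 3 * \<epsilon> / 4 * y" using \<epsilon> y4 by simp
  then have q_y: "y \<le> real q" using q_ge by (simp add: algebra_simps)
  have q1: "q \<ge> 1" using q_y y4 by linarith
  define \<rho> where "\<rho> = 2 * exp (- (\<kappa> * X))"
  have \<rho>: "0 < \<rho>" "\<rho> \<le> 1" using c4 by (auto simp: \<rho>_def)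
  \<comment> \<open>The size sums of the blocks add up to at most \<open>G * Y * N\<close>, so at
    most \<open>\<epsilon> / 4 * y\<close> blocks exceed this threshold.\<close>
  define B where "B = 8 * G / (\<epsilon> * c) * (Y * Z * X)"
  have Bpos: "B > 0" using G \<epsilon> c X Y Z by (simp add: B_def)
  have Zr: "y * (Z * real r) = c * N" using r Z by (simp add: y_def \<mu>_def)
  have blocks: "(\<Prod>j<q. measure_pmf.prob (F (\<lambda>i. card (cut_block n V j i))) {H. r \<le> L H}) \<le> (\<rho> powr (\<epsilon> / 8)) ^ q"
    if V: "\<And>i. V i \<subseteq> {1..n i}" "\<And>i. card (V i) = q" for V
  proof -
    define s where "s j = (\<lambda>i. card (cut_block n V j i))" for j
    have fincut: "finite (cut_block n V j i)" for j i by (simp add: cut_block_def)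
    have s_pos: "s j i > 0" if "j < q" for j i
      using cut_block_nonempty[of V i n q j] V that fincut by (simp add: s_def card_gt_0_iff)
    have s_sum: "(\<Sum>j<q. s j i) \<le> n i" for i unfolding s_def by (rule sum_card_cut_block_le)
    \<comment> \<open>At geometric mean \<open>x\<close> the value \<open>c * x / Z\<close> equals
      \<open>r / (1 + \<epsilon> / 4)\<close>. The geometric means sum to at most \<open>N\<close>,
      which allows at most \<open>(1 + \<epsilon> / 4) * y\<close> blocks above
      \<open>x\<close>.\<close>
    define x where "x = real r * Z / (c * (1 + \<epsilon> / 4))"
    have xpos: "x > 0" using r Z c \<epsilon> by (simp add: x_def)
    define bad1 where "bad1 = {j \<in> {..<q}. x < geo_mean (s j)}"
    define bad2 where "bad2 = {j \<in> {..<q}. B < class_size_sum (s j)}"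
    define good where "good = {..<q} - (bad1 \<union> bad2)"
    have "real (card bad1) * x \<le> N"
      unfolding bad1_def N_def using s_sum n
      by (intro card_large_le sum_geo_mean_le) auto
    then have "real (card bad1) \<le> N / x" using xpos by (simp add: pos_le_divide_eq)
    also have "N / x = (1 + \<epsilon> / 4) * y" using c Z r by (simp add: x_def y_def \<mu>_def mult_ac)
    finally have bad1: "real (card bad1) \<le> (1 + \<epsilon> / 4) * y" .
    have "(\<Sum>j<q. class_size_sum (s j)) = (\<Sum>i\<in>UNIV. real (\<Sum>j<q. s j i))"
      unfolding class_size_sum_def by (subst sum.swap) simp
    also have "\<dots> \<le> class_size_sum n"
      unfolding class_size_sum_def using s_sum by (intro sum_mono of_nat_mono)
    finally have "(\<Sum>j<q. class_size_sum (s j)) \<le> G * Y * N" using S by (simp add: N_def)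
    then have "real (card bad2) * B \<le> G * Y * N"
      unfolding bad2_def by (intro card_large_le) (auto simp: class_size_sum_def sum_nonneg)
    then have "real (card bad2) \<le> G * Y * N / B" using Bpos by (simp add: pos_le_divide_eq)
    also have "\<dots> \<le> \<epsilon> / 4 * y"
    proof -
      have "G * Y * N = G * Y * (y * (Z * real r)) / c" using Zr c by simp
      also have "\<dots> \<le> G * Y * (y * (Z * (2 * X))) / c"
        using r G Y Z y4 c by (intro divide_right_mono mult_left_mono) auto
      also have "\<dots> = \<epsilon> / 4 * y * B" using \<epsilon> c by (simp add: B_def)
      finally show ?thesis using Bpos by (simp add: pos_divide_le_eq)
    qed
    finally have bad2: "real (card bad2) \<le> \<epsilon> / 4 * y" .
    have "q \<le> card good + card (bad1 \<union> bad2)"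
    proof -
      have "card {..<q} \<le> card (good \<union> (bad1 \<union> bad2))"
        by (intro card_mono) (auto simp: good_def bad1_def bad2_def)
      also have "\<dots> \<le> card good + card (bad1 \<union> bad2)" by (rule card_Un_le)
      finally show ?thesis by simp
    qed
    also have "card (bad1 \<union> bad2) \<le> card bad1 + card bad2" by (rule card_Un_le)
    finally have "real q \<le> real (card good) + (real (card bad1) + real (card bad2))"
      by (simp flip: of_nat_add)
    \<comment> \<open>Of at least \<open>(1 + 3 * \<epsilon> / 4) * y\<close> blocks at most
      \<open>(1 + \<epsilon> / 2) * y\<close> are bad; the rest is a positive fraction of
      \<open>q\<close> because \<open>q \<le> 2 * y\<close>.\<close>
    then have "\<epsilon> / 4 * y \<le> real (card good)"
      using bad1 bad2 q_ge by (simp add: algebra_simps)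
    moreover have "\<epsilon> / 8 * real q \<le> \<epsilon> / 4 * y"
    proof -
      have "\<epsilon> / 8 * real q \<le> \<epsilon> / 8 * ((1 + \<epsilon>) * y)" using q \<epsilon> by (intro mult_left_mono) auto
      also have "\<dots> \<le> \<epsilon> / 8 * (2 * y)" using \<epsilon> y4 by (intro mult_left_mono mult_right_mono) auto
      finally show ?thesis by simp
    qed
    ultimately have good: "\<epsilon> / 8 * real q \<le> real (card good)" by linarith
    have tail: "measure_pmf.prob (F (s j)) {H. r \<le> L H} \<le> \<rho>" if j: "j \<in> good" for j
    proof -
      have jq: "j < q" and gx: "geo_mean (s j) \<le> x" and sB: "class_size_sum (s j) \<le> B"
        using j by (auto simp: good_def bad1_def bad2_def)
      have "measure_pmf.prob (F (s j)) {H. r \<le> L H}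
          \<le> 2 * exp (- (h * ((\<epsilon> / 8) / (1 + \<epsilon> / 8))\<^sup>2 * real r))"
      proof (rule block_upper_tail[OF model cc h c a b Z, where \<delta> = "\<epsilon> / 16" and T = T])
        show "0 < \<epsilon> / 16" "\<epsilon> / 16 < 1" "0 < \<epsilon> / 8" using \<epsilon> by auto
        show "\<And>i. s j i > 0" using s_pos jq by blast
        have "(1 + \<epsilon> / 8) * (1 + \<epsilon> / 16) \<le> 1 + \<epsilon> / 4"
        proof -
          have "\<epsilon> * \<epsilon> \<le> \<epsilon>" using \<epsilon> mult_left_mono[of \<epsilon> 1 \<epsilon>] by simp
          moreover have "(1 + \<epsilon> / 8) * (1 + \<epsilon> / 16) = 1 + 3 / 16 * \<epsilon> + \<epsilon> * \<epsilon> / 128"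
            by (simp add: algebra_simps)
          ultimately show ?thesis using \<epsilon> by linarith
        qed
        moreover have "c * geo_mean (s j) / Z \<le> c * x / Z"
          using gx c Z by (intro divide_right_mono mult_left_mono) auto
        ultimately have "(1 + \<epsilon> / 8) * (1 + \<epsilon> / 16) * (c * geo_mean (s j) / Z) \<le> (1 + \<epsilon> / 4) * (c * x / Z)"
          using \<epsilon> c Z by (intro mult_mono) auto
        also have "\<dots> = real r" using \<epsilon> c Z by (simp add: x_def)
        finally show "(1 + \<epsilon> / 8) * (1 + \<epsilon> / 16) * (c * geo_mean (s j) / Z) \<le> real r" .
        show "(1 + \<epsilon> / 8) * (1 + \<epsilon> / 16) * (2 * a * c) \<le> real r" using c1 r by linarith
        have YX: "1 \<le> Y * X" using mult_mono[OF Y X] X Y by simp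
        have "Z * 1 \<le> Z * (Y * X)" using YX Z by (intro mult_left_mono) auto
        then have ZZ: "Z \<le> Y * Z * X" by (simp add: mult_ac)
        then have "a * Z \<le> a * (Y * Z * X)" using a by (intro mult_left_mono) auto
        then have "a * Z + 1 \<le> (a + 1) * (Y * Z * X)"
          using ZZ Z unfolding distrib_right by linarith
        then have "real CARD('d) * (a * Z + 1) \<le> real CARD('d) * ((a + 1) * (Y * Z * X))"
          by (intro mult_left_mono) auto
        then have "class_size_sum (s j) + real CARD('d) * (a * Z + 1)
            \<le> (8 * G / (\<epsilon> * c) + real CARD('d) * (a + 1)) * (Y * Z * X)"
          using sB unfolding B_def distrib_right mult.assoc by linarith
        then have "(class_size_sum (s j) + real CARD('d) * (a * Z + 1)) * b
            \<le> (8 * G / (\<epsilon> * c) + real CARD('d) * (a + 1)) * (Y * Z * X) * b"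
          using b by (intro mult_right_mono) auto
        then show "(class_size_sum (s j) + real CARD('d) * (a * Z + 1)) * b \<le> T"
          using c2 by (simp add: mult_ac)
      qed (use win in auto)
      also have "\<dots> = 2 * exp (- (\<kappa> * real r))" by (simp add: \<kappa>)
      also have "\<dots> \<le> \<rho>" using \<kappa>0 r by (simp add: \<rho>_def)
      finally show ?thesis .
    qed
    \<comment> \<open>Bad blocks contribute a factor at most 1.\<close>
    have "(\<Prod>j<q. measure_pmf.prob (F (s j)) {H. r \<le> L H}) \<le> (\<Prod>j<q. if j \<in> good then \<rho> else 1)"
      using tail by (intro prod_mono) auto
    also have "\<dots> = \<rho> ^ card good"
    proof -
      have "{..<q} \<inter> {j. j \<in> good} = good" by (auto simp: good_def)
      then show ?thesis by (simp add: prod.If_cases)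
    qed
    also have "\<dots> = \<rho> powr real (card good)" using \<rho> by (simp add: powr_realpow)
    also have "\<dots> \<le> \<rho> powr (\<epsilon> / 8 * real q)" using \<rho> good by (intro powr_mono') auto
    also have "\<dots> = (\<rho> powr (\<epsilon> / 8)) ^ q" using \<rho> by (simp add: powr_powr flip: powr_realpow)
    finally show ?thesis by (simp add: s_def)
  qed
  \<comment> \<open>The 6 comes from \<open>exp 1 \<le> 3\<close> and \<open>r \<le> 2 * X\<close>.
    \<open>?Q\<close> dominates \<open>exp 1 * n i / q\<close> in every class, so each block
    contributes a factor \<open>?Q ^ CARD('d)\<close> to the bound on the number of cuts.\<close>
  let ?Q = "6 * G / c * (Y * Z * X)"
  have count: "(\<Prod>i\<in>UNIV. real (n i choose q)) \<le> (?Q ^ CARD('d)) ^ q"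
  proof -
    have "real (n i choose q) \<le> ?Q ^ q" for i
    proof -
      have "real (n i) \<le> G * Y * N" using class_size_le_sum[of n i] S by (simp add: N_def)
      also have "\<dots> = G * Y * (y * (Z * real r)) / c" using Zr c by simp
      also have "\<dots> \<le> G * Y * (real q * (Z * (2 * X))) / c"
        using r q_y G Y Z y4 c by (intro divide_right_mono mult_left_mono mult_mono) auto
      finally have "3 * real (n i) / real q \<le> 3 * (G * Y * (real q * (Z * (2 * X))) / c) / real q"
        by (intro divide_right_mono mult_left_mono) auto
      also have "\<dots> = ?Q" using q1 by simp
      finally have Q: "3 * real (n i) / real q \<le> ?Q" .
      have "exp 1 * real (n i) / real q \<le> 3 * real (n i) / real q"
        using exp_le by (intro divide_right_mono mult_right_mono) auto
      then have "exp 1 * real (n i) / real q \<le> ?Q" using Q by linarith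
      then have "(exp 1 * real (n i) / real q) ^ q \<le> ?Q ^ q" by (intro power_mono) auto
      then show ?thesis using binomial_le_exp_power[of q "n i"] q1 by simp
    qed
    then have "(\<Prod>i\<in>UNIV. real (n i choose q)) \<le> (\<Prod>i\<in>(UNIV::'d set). ?Q ^ q)"
      by (intro prod_mono) auto
    also have "\<dots> = (?Q ^ CARD('d)) ^ q" by (simp flip: power_mult add: mult.commute)
    finally show ?thesis .
  qed
  \<comment> \<open>The combined factor per block, cuts times tail; being below 1/2, it stays so
    after raising to the power \<open>q \<ge> 1\<close>.\<close>
  define \<beta> where "\<beta> = ?Q ^ CARD('d) * \<rho> powr (\<epsilon> / 8)"
  have \<beta>: "0 \<le> \<beta>" "\<beta> < 1 / 2" using c5 G c X Y Z by (auto simp: \<beta>_def \<rho>_def)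
  have "real q * real r \<le> (1 + \<epsilon>) * y * real r" using q by (intro mult_right_mono) auto
  also have "\<dots> = (1 + \<epsilon>) * \<mu>" using r by (simp add: y_def)
  finally have "real (q * r) \<le> (1 + \<epsilon>) * \<mu>" by simp
  then have "measure_pmf.prob (F n) {H. (1 + \<epsilon>) * \<mu> \<le> real (L H)} \<le> measure_pmf.prob (F n) {H. q * r \<le> L H}"
    by (intro measure_pmf_mono) (auto simp flip: of_nat_mult intro: order_trans of_nat_le_iff[THEN iffD1])
  also have "\<dots> \<le> (\<Prod>i\<in>UNIV. real (n i choose q)) * (\<rho> powr (\<epsilon> / 8)) ^ q"
    by (rule union_bound_cut_blocks[OF model r(3) blocks])
  also have "\<dots> \<le> (?Q ^ CARD('d)) ^ q * (\<rho> powr (\<epsilon> / 8)) ^ q"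
    using count by (intro mult_right_mono) auto
  also have "\<dots> = \<beta> ^ q" by (simp add: \<beta>_def power_mult_distrib)
  also have "\<dots> \<le> \<beta> ^ 1" using \<beta> q1 by (intro power_decreasing) auto
  finally show ?thesis using \<beta> unfolding \<mu>_def N_def by simp
qed

lemma upper_bound:
  fixes D :: "real \<Rightarrow> ('d::finite \<Rightarrow> nat) \<Rightarrow> ('d \<Rightarrow> nat) set pmf" and h c lam \<theta> \<eta> :: real
  assumes h: "h > 0" and c: "c > 0" and lam: "lam \<ge> 0" and \<eta>: "0 \<le> \<eta>"
    and gap: "\<eta> < \<theta> - lam" and g: "g \<in> O[at_top](\<lambda>t. t powr \<eta>)"
    and model: "\<And>t. random_hypergraph_model (D t)"
    and cc: "\<And>t n. concentration_constant (D t n) h"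
    and med: "approximate_median_on UNIV D c lam \<theta>"
    and \<epsilon>: "0 < \<epsilon>" "\<epsilon> \<le> 1"
  shows "\<exists>t0 A. \<forall>t\<ge>t0. \<forall>n. (\<forall>i. n i > 0) \<longrightarrow> geo_mean n \<ge> A * t powr lam \<longrightarrow>
      class_size_sum n \<le> g t * geo_mean n \<longrightarrow>
      (\<forall>m. is_median_L (D t n) m \<longrightarrow> m \<le> (1 + \<epsilon>) * (c * geo_mean n / t powr lam))"
proof -
  have \<epsilon>16: "\<epsilon> / 16 > 0" using \<epsilon> by simp
  obtain a b t' where ab: "a \<ge> 1" "b \<ge> 1" and
    win: "\<forall>t n m. t \<ge> t' \<longrightarrow> n \<in> UNIV \<longrightarrow> (\<forall>i. n i > 0) \<longrightarrow> geo_mean n \<ge> a * t powr lam \<longrightarrow>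
       class_size_sum n * b \<le> t powr \<theta> \<longrightarrow> is_median_L (D t n) m \<longrightarrow>
       (1 - \<epsilon> / 16) * (c * geo_mean n / t powr lam) \<le> m \<and> m \<le> (1 + \<epsilon> / 16) * (c * geo_mean n / t powr lam)"
    using approximate_median_onE[OF med \<epsilon>16] .
  note win = win[rule_format, OF _ UNIV_I]
  obtain G where G: "G \<ge> 1" and gG: "\<forall>\<^sub>F t in at_top. g t \<le> G * t powr \<eta>"
    using balance_constant[OF g] .
  \<comment> \<open>With a quarter of the exponent gap, \<open>t powr \<theta>\<close> equals
    \<open>X ^ 4 * Z * Y\<close>; this leaves a factor \<open>X ^ 3\<close> to absorb the constants
    in both \<open>c2\<close> and \<open>c3\<close>.\<close>
  define \<tau> where "\<tau> = (\<theta> - lam - \<eta>) / 4"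
  have \<tau>: "\<tau> > 0" using gap by (simp add: \<tau>_def)
  define \<kappa> where "\<kappa> = h * ((\<epsilon> / 8) / (1 + \<epsilon> / 8))\<^sup>2"
  have \<kappa>: "\<kappa> > 0" using h \<epsilon> unfolding \<kappa>_def by (intro mult_pos_pos zero_less_power divide_pos_pos) auto
  \<comment> \<open>\<open>t powr p\<close> is the growth of the number of cuts per block, taken
    over all classes.\<close>
  define p where "p = (\<eta> + lam + \<tau>) * real CARD('d)"
  have lim: "((\<lambda>t. (6 * G / c) ^ CARD('d) * t powr p * (2 * exp (- (\<kappa> * t powr \<tau>))) powr (\<epsilon> / 8)) \<longlongrightarrow> 0) at_top"
    using \<kappa> \<tau> \<epsilon> G c by real_asymp
  have lim2: "((\<lambda>t. 2 * exp (- (\<kappa> * t powr \<tau>))) \<longlongrightarrow> 0) at_top"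
    using \<kappa> \<tau> by real_asymp
  have "\<forall>\<^sub>F t in at_top. t \<ge> 1 \<and> t \<ge> t' \<and> g t \<le> G * t powr \<eta> \<and>
      ((1 + \<epsilon> / 8) * (1 + \<epsilon> / 16) * (2 * a * c)) * t powr 0 \<le> t powr \<tau> \<and>
      (b * (8 * G / (\<epsilon> * c) + real CARD('d) * (a + 1))) * t powr (\<eta> + lam + \<tau>) \<le> t powr \<theta> \<and>
      8 * b * G / (\<epsilon> * c) * t powr \<tau> \<le> t powr (4 * \<tau>) \<and>
      2 * exp (- (\<kappa> * t powr \<tau>)) < 1 \<and>
      (6 * G / c) ^ CARD('d) * t powr p * (2 * exp (- (\<kappa> * t powr \<tau>))) powr (\<epsilon> / 8) < 1 / 2"
    using \<tau> gap
    by (intro eventually_conj eventually_ge_at_top gG eventually_powr_dominates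
        order_tendstoD(2)[OF lim] order_tendstoD(2)[OF lim2]) (auto simp: \<tau>_def field_simps)
  then obtain t0 where t0: "\<And>t. t \<ge> t0 \<Longrightarrow> t \<ge> 1 \<and> t \<ge> t' \<and> g t \<le> G * t powr \<eta> \<and>
      ((1 + \<epsilon> / 8) * (1 + \<epsilon> / 16) * (2 * a * c)) * t powr 0 \<le> t powr \<tau> \<and>
      (b * (8 * G / (\<epsilon> * c) + real CARD('d) * (a + 1))) * t powr (\<eta> + lam + \<tau>) \<le> t powr \<theta> \<and>
      8 * b * G / (\<epsilon> * c) * t powr \<tau> \<le> t powr (4 * \<tau>) \<and>
      2 * exp (- (\<kappa> * t powr \<tau>)) < 1 \<and>
      (6 * G / c) ^ CARD('d) * t powr p * (2 * exp (- (\<kappa> * t powr \<tau>))) powr (\<epsilon> / 8) < 1 / 2"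
    by (auto simp: eventually_at_top_linorder)
  show ?thesis
  proof (rule exI[of _ t0], rule exI[of _ a], intro allI impI)
    fix t n m
    assume t: "t \<ge> t0" and n: "\<forall>i. n i > 0" and Na: "geo_mean n \<ge> a * t powr lam"
      and S: "class_size_sum n \<le> g t * geo_mean n" and m: "is_median_L (D t n) m"
    note t0 = t0[OF t]
    have "t \<ge> 1" using t0 by simp
    define X Y Z where "X = t powr \<tau>" and "Y = t powr \<eta>" and "Z = t powr lam"
    have XYZ: "X \<ge> 1" "Y \<ge> 1" "Z \<ge> 1"
      unfolding X_def Y_def Z_def using \<open>t \<ge> 1\<close> \<tau> \<eta> lam by (auto intro!: ge_one_powr_ge_zero)
    have X4: "t powr (4 * \<tau>) = X ^ 4"
      using \<open>t \<ge> 1\<close> by (simp add: X_def powr_powr mult.commute flip: powr_realpow)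
    have T: "t powr \<theta> = X ^ 4 * Z * Y"
    proof -
      have "4 * \<tau> = \<theta> - lam - \<eta>" by (simp add: \<tau>_def)
      then have "\<theta> = 4 * \<tau> + lam + \<eta>" by simp
      then show ?thesis by (simp add: powr_add Z_def Y_def flip: X4)
    qed
    have YZX: "t powr (\<eta> + lam + \<tau>) = Y * Z * X" by (simp add: X_def Y_def Z_def powr_add)
    have tp: "t powr p = (Y * Z * X) ^ CARD('d)"
      unfolding p_def YZX[symmetric] using \<open>t \<ge> 1\<close> by (simp add: powr_powr flip: powr_realpow)
    have \<mu>: "0 \<le> c * geo_mean n / t powr lam" using c by simp
    have "g t * geo_mean n \<le> G * Y * geo_mean n" using t0 by (intro mult_right_mono) (auto simp: Y_def)
    then have SG: "class_size_sum n \<le> G * Y * geo_mean n" using S by linarith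
    show "m \<le> (1 + \<epsilon>) * (c * geo_mean n / t powr lam)"
    proof (cases "class_size_sum n * b \<le> t powr \<theta>")
      case True
      then have "m \<le> (1 + \<epsilon> / 16) * (c * geo_mean n / t powr lam)"
        using win[of t n m] t0 n Na m by blast
      also have "\<dots> \<le> (1 + \<epsilon>) * (c * geo_mean n / t powr lam)"
        using \<mu> \<epsilon> by (intro mult_right_mono) auto
      finally show ?thesis .
    next
      case False
      have half: "measure_pmf.prob (D t n) {H. (1 + \<epsilon>) * (c * geo_mean n / Z) \<le> real (L H)} < 1 / 2"
      proof (rule upper_tail_half[OF model cc h c \<epsilon> ab G XYZ _ T \<kappa>_def])
        show "(1 - \<epsilon> / 16) * (c * geo_mean v / Z) \<le> m' \<and> m' \<le> (1 + \<epsilon> / 16) * (c * geo_mean v / Z)"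
          if "\<forall>i. v i > 0" "a * Z \<le> geo_mean v" "class_size_sum v * b \<le> t powr \<theta>" "is_median_L (D t v) m'"
          for v m'
          using win[of t v m'] t0 that by (auto simp: Z_def)
        show "(1 + \<epsilon> / 8) * (1 + \<epsilon> / 16) * (2 * a * c) \<le> X" using t0 \<open>t \<ge> 1\<close> by (simp add: X_def)
        show "b * (8 * G / (\<epsilon> * c) + real CARD('d) * (a + 1)) * (Y * Z * X) \<le> t powr \<theta>"
          using t0 unfolding YZX by blast
        show "8 * b * G / (\<epsilon> * c) * X \<le> X ^ 4" using t0 unfolding X4 X_def by blast
        show "2 * exp (- (\<kappa> * X)) \<le> 1" using t0 by (simp add: X_def)
        show "(6 * G / c * (Y * Z * X)) ^ CARD('d) * (2 * exp (- (\<kappa> * X))) powr (\<epsilon> / 8) < 1 / 2"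
          using t0 unfolding tp power_mult_distrib[of "6 * G / c"] X_def[symmetric] by blast
      qed (use n SG False in auto)
      show ?thesis
      proof (rule ccontr)
        \<comment> \<open>A median above the threshold would give the upper tail probability at
          least one half.\<close>
        assume "\<not> m \<le> (1 + \<epsilon>) * (c * geo_mean n / t powr lam)"
        then have "measure_pmf.prob (D t n) {H. real (L H) \<ge> m}
            \<le> measure_pmf.prob (D t n) {H. (1 + \<epsilon>) * (c * geo_mean n / Z) \<le> real (L H)}"
          by (intro measure_pmf_mono) (auto simp: Z_def)
        then show False using half m by (simp add: is_median_L_def)
      qed
    qed
  qed
qed

section \<open>The main theorem\<close>

text \<open>For \<open>\<epsilon> > 1\<close> the threshold is negative. Otherwise
  \<open>1 - \<epsilon> \<le> (1 - \<epsilon> / 2)\<^sup>2\<close> puts the event a factor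
  \<open>1 - \<epsilon> / 2\<close> below the median, and \<open>m \<ge> \<mu> / 2\<close> gives the
  exponent \<open>h * \<epsilon>\<^sup>2 * \<mu> / 8\<close>. The premise \<open>large\<close>
  absorbs the factor 2; stated with \<open>\<epsilon>\<^sup>2 / (1 + \<epsilon>)\<close>, it serves
  both tails.\<close>

lemma lower_tail_near_median:
  assumes cc: "concentration_constant F h" and h: "h > 0" and \<epsilon>: "\<epsilon> > 0" and \<mu>: "\<mu> > 0"
    and m: "is_median_L F m" "(1 - min \<epsilon> 1 / 2) * \<mu> \<le> m"
    and large: "ln 2 \<le> h * (\<epsilon>\<^sup>2 / (1 + \<epsilon>)) * \<mu> / 24"
  shows "measure_pmf.prob F {H. real (L H) \<le> (1 - \<epsilon>) * \<mu>} \<le> exp (- (1/24) * h * \<epsilon>\<^sup>2 * \<mu>)"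
proof (cases "\<epsilon> \<le> 1")
  case False
  then have "(1 - \<epsilon>) * \<mu> < 0" using \<mu> by (intro mult_neg_pos) auto
  then have "{H :: ('a \<Rightarrow> nat) set. real (L H) \<le> (1 - \<epsilon>) * \<mu>} = {}"
    by (auto simp: not_le intro: less_le_trans)
  then show ?thesis by simp
next
  case True
  define \<delta> where "\<delta> = \<epsilon> / 2"
  have \<delta>: "0 < \<delta>" "\<delta> \<le> 1 / 2" using \<epsilon> True by (auto simp: \<delta>_def)
  have m\<delta>: "(1 - \<delta>) * \<mu> \<le> m" using m(2) True by (simp add: \<delta>_def)
  have "(1 - \<epsilon>) * \<mu> \<le> (1 - \<delta>) * ((1 - \<delta>) * \<mu>)"
    using \<mu> \<epsilon> by (simp add: \<delta>_def algebra_simps)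
  also have "\<dots> \<le> (1 - \<delta>) * m" using m\<delta> \<delta> by (intro mult_left_mono) auto
  finally have le: "(1 - \<epsilon>) * \<mu> \<le> (1 - \<delta>) * m" .
  have "1 / 2 * \<mu> \<le> (1 - \<delta>) * \<mu>" using \<delta> \<mu> by (intro mult_right_mono) auto
  then have half: "\<mu> / 2 \<le> m" using m\<delta> by linarith
  have "h * \<epsilon>\<^sup>2 * \<mu> / 8 = h * \<delta>\<^sup>2 * (\<mu> / 2)" by (simp add: \<delta>_def power2_eq_square)
  also have "\<dots> \<le> h * \<delta>\<^sup>2 * m" using half h by (intro mult_left_mono) auto
  finally have e1: "h * \<epsilon>\<^sup>2 * \<mu> / 8 \<le> h * \<delta>\<^sup>2 * m" .
  have "\<epsilon>\<^sup>2 / (1 + \<epsilon>) \<le> \<epsilon>\<^sup>2" using \<epsilon> by (simp add: field_simps)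
  then have "h * (\<epsilon>\<^sup>2 / (1 + \<epsilon>)) * \<mu> \<le> h * \<epsilon>\<^sup>2 * \<mu>"
    using h \<mu> by (intro mult_right_mono mult_left_mono) auto
  moreover have "0 \<le> h * \<epsilon>\<^sup>2 * \<mu>" using h \<mu> by simp
  moreover have "A \<le> B \<Longrightarrow> 0 \<le> B \<Longrightarrow> ln 2 \<le> A / 24 \<Longrightarrow> B / 8 \<le> C \<Longrightarrow> ln 2 - C \<le> - (B / 24)"
    for A B C :: real by linarith
  ultimately have e2: "ln 2 - h * \<delta>\<^sup>2 * m \<le> - (h * \<epsilon>\<^sup>2 * \<mu> / 24)" using large e1 by blast
  have "measure_pmf.prob F {H. real (L H) \<le> (1 - \<epsilon>) * \<mu>}
      \<le> measure_pmf.prob F {H. real (L H) \<le> (1 - \<delta>) * m}"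
    using le by (intro measure_pmf_mono) auto
  also have "\<dots> \<le> 2 * exp (- h * \<delta>\<^sup>2 * m)" using lower_tailD[OF cc m(1)] \<delta> by simp
  also have "\<dots> = exp (ln 2 - h * \<delta>\<^sup>2 * m)" by (simp add: exp_diff exp_minus field_simps)
  also have "\<dots> \<le> exp (- (h * \<epsilon>\<^sup>2 * \<mu> / 24))" using e2 unfolding exp_le_cancel_iff .
  also have "\<dots> = exp (- (1/24) * h * \<epsilon>\<^sup>2 * \<mu>)" by simp
  finally show ?thesis .
qed

text \<open>\<open>s\<close> solves \<open>(1 + s) * (1 + \<delta>) = 1 + \<epsilon>\<close>. The
  exponent loses a factor 6 from \<open>\<epsilon> - \<delta> \<ge> \<epsilon> / 2\<close> and
  \<open>1 + \<delta> \<le> 3 / 2\<close>, a factor 2 from \<open>m \<ge> \<mu> / 2\<close>, and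
  half of the remainder absorbs the factor 2 in front; hence 24.\<close>

lemma upper_tail_near_median:
  assumes cc: "concentration_constant F h" and h: "h > 0" and \<epsilon>: "\<epsilon> > 0" and \<mu>: "\<mu> > 0"
    and m: "is_median_L F m" "(1 - min \<epsilon> 1 / 2) * \<mu> \<le> m" "m \<le> (1 + min \<epsilon> 1 / 2) * \<mu>"
    and large: "ln 2 \<le> h * (\<epsilon>\<^sup>2 / (1 + \<epsilon>)) * \<mu> / 24"
  shows "measure_pmf.prob F {H. real (L H) \<ge> (1 + \<epsilon>) * \<mu>} \<le> exp (- (1/24) * h * (\<epsilon>\<^sup>2 / (1 + \<epsilon>)) * \<mu>)"
proof -
  define \<delta> where "\<delta> = min \<epsilon> 1 / 2"
  have \<delta>: "0 < \<delta>" "\<delta> \<le> 1 / 2" "\<epsilon> / 2 \<le> \<epsilon> - \<delta>" using \<epsilon> by (auto simp: \<delta>_def min_def)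
  have m\<delta>: "(1 - \<delta>) * \<mu> \<le> m" "m \<le> (1 + \<delta>) * \<mu>" using m by (auto simp: \<delta>_def)
  define s where "s = (\<epsilon> - \<delta>) / (1 + \<delta>)"
  have s: "s > 0" using \<delta> \<epsilon> by (simp add: s_def)
  have "s * (1 + \<delta>) = \<epsilon> - \<delta>" using \<delta> by (simp add: s_def)
  then have s\<delta>: "(1 + s) * (1 + \<delta>) = 1 + \<epsilon>" unfolding distrib_right by simp
  then have s1: "1 + s = (1 + \<epsilon>) / (1 + \<delta>)" using \<delta> by (subst nonzero_eq_divide_eq) auto
  have "(1 + s) * m \<le> (1 + s) * ((1 + \<delta>) * \<mu>)" using m\<delta> s by (intro mult_left_mono) auto
  also have "\<dots> = (1 + \<epsilon>) * \<mu>" unfolding s\<delta>[symmetric] by simp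
  finally have le: "(1 + s) * m \<le> (1 + \<epsilon>) * \<mu>" .
  have "1 / 2 * \<mu> \<le> (1 - \<delta>) * \<mu>" using \<delta> \<mu> by (intro mult_right_mono) auto
  then have half: "\<mu> / 2 \<le> m" using m\<delta> by linarith
  have "\<epsilon>\<^sup>2 / (1 + \<epsilon>) / 6 = (\<epsilon> / 2)\<^sup>2 / ((3 / 2) * (1 + \<epsilon>))"
    by (simp add: power2_eq_square)
  also have "\<dots> \<le> (\<epsilon> - \<delta>)\<^sup>2 / ((1 + \<delta>) * (1 + \<epsilon>))"
    using \<delta> \<epsilon> by (intro frac_le power_mono mult_right_mono mult_pos_pos) auto
  also have "\<dots> = s\<^sup>2 / (1 + s)" 
    unfolding s1 using \<delta> \<epsilon> by (simp add: s_def power2_eq_square)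
  finally have "h * (\<epsilon>\<^sup>2 / (1 + \<epsilon>) / 6) * (\<mu> / 2) \<le> h * (s\<^sup>2 / (1 + s)) * m"
    using half h \<mu> s by (intro mult_mono mult_left_mono) auto
  moreover have "h * (\<epsilon>\<^sup>2 / (1 + \<epsilon>) / 6) * (\<mu> / 2) = h * (\<epsilon>\<^sup>2 / (1 + \<epsilon>)) * \<mu> / 12" by simp
  moreover have "A \<le> C \<Longrightarrow> A = B / 12 \<Longrightarrow> ln 2 \<le> B / 24 \<Longrightarrow> ln 2 - C \<le> - (B / 24)"
    for A B C :: real by linarith
  ultimately have e: "ln 2 - h * (s\<^sup>2 / (1 + s)) * m \<le> - (h * (\<epsilon>\<^sup>2 / (1 + \<epsilon>)) * \<mu> / 24)"
    using large by blast
  have "measure_pmf.prob F {H. real (L H) \<ge> (1 + \<epsilon>) * \<mu>}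
      \<le> measure_pmf.prob F {H. real (L H) \<ge> (1 + s) * m}"
    using le by (intro measure_pmf_mono) auto
  also have "\<dots> \<le> 2 * exp (- h * (s\<^sup>2 / (1 + s)) * m)" using upper_tailD[OF cc m(1)] s by simp
  also have "\<dots> = exp (ln 2 - h * (s\<^sup>2 / (1 + s)) * m)" by (simp add: exp_diff exp_minus field_simps)
  also have "\<dots> \<le> exp (- (h * (\<epsilon>\<^sup>2 / (1 + \<epsilon>)) * \<mu> / 24))" using e unfolding exp_le_cancel_iff .
  also have "\<dots> = exp (- (1/24) * h * (\<epsilon>\<^sup>2 / (1 + \<epsilon>)) * \<mu>)" by simp
  finally show ?thesis .
qed

text \<open>The lower bound on \<open>A\<close> makes the predicted value large enough to absorb the
  factor 2 of the concentration inequalities.\<close>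

lemma large_mean:
  fixes c N Z A h \<epsilon> :: real
  assumes "c > 0" "h > 0" "\<epsilon> > 0" "Z > 0" "A * Z \<le> N" "24 * ln 2 * (1 + \<epsilon>) / (h * \<epsilon>\<^sup>2 * c) \<le> A"
  shows "c * A \<le> c * N / Z" "c * N / Z > 0" "ln 2 \<le> h * (\<epsilon>\<^sup>2 / (1 + \<epsilon>)) * (c * N / Z) / 24"
proof -
  have "A \<le> N / Z" using assms by (simp add: pos_le_divide_eq)
  then show *: "c * A \<le> c * N / Z" using assms(1) mult_left_mono[of A "N / Z" c] by simp
  have "0 < 24 * ln 2 * (1 + \<epsilon>) / (h * \<epsilon>\<^sup>2 * c)" using assms by simp
  then have "0 < A" using assms(6) by linarith
  then show "c * N / Z > 0" using * assms(1) by (smt (verit) mult_pos_pos)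
  define k where "k = h * (\<epsilon>\<^sup>2 / (1 + \<epsilon>))"
  have k: "k > 0" using assms by (simp add: k_def)
  have "ln 2 = k * (c * (24 * ln 2 * (1 + \<epsilon>) / (h * \<epsilon>\<^sup>2 * c))) / 24"
    using assms by (simp add: k_def)
  also have "\<dots> \<le> k * (c * A) / 24"
    using assms k by (intro divide_right_mono mult_left_mono) auto
  also have "\<dots> \<le> k * (c * N / Z) / 24"
    using * k by (intro divide_right_mono mult_left_mono) auto
  finally show "ln 2 \<le> h * (\<epsilon>\<^sup>2 / (1 + \<epsilon>)) * (c * N / Z) / 24" by (simp add: k_def)
qed

lemma strong_model_bounds:
  fixes D :: "real \<Rightarrow> ('d::finite \<Rightarrow> nat) \<Rightarrow> ('d \<Rightarrow> nat) set pmf" and h c lam \<theta> \<eta> :: real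
  assumes h: "h > 0" and c: "c > 0" and lam: "lam \<ge> 0" and \<eta>: "0 \<le> \<eta>"
    and \<eta>_le: "CARD('d) \<ge> 2 \<Longrightarrow> \<eta> \<le> lam / (real CARD('d) - 1)"
    and gap: "\<eta> < \<theta> - lam" and g: "g \<in> O[at_top](\<lambda>t. t powr \<eta>)"
    and model: "\<And>t. random_hypergraph_model (D t)"
    and cc: "\<And>t n. concentration_constant (D t n) h"
    and med: "approximate_median D c lam \<theta>" and \<epsilon>: "\<epsilon> > 0"
  shows "\<exists>t0 A. \<forall>t\<ge>t0. \<forall>n.
         (\<forall>i. n i > 0) \<and> geo_mean n \<ge> A * t powr lam \<and> class_size_sum n \<le> g t * geo_mean n \<longrightarrow>
         (let \<mu> = c * geo_mean n / t powr lam in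
            (1 - \<epsilon>) * \<mu> \<le> measure_pmf.expectation (D t n) (\<lambda>H. real (L H)) \<and>
            measure_pmf.expectation (D t n) (\<lambda>H. real (L H)) \<le> (1 + \<epsilon>) * \<mu> \<and>
            (\<forall>m. is_median_L (D t n) m \<longrightarrow> (1 - \<epsilon>) * \<mu> \<le> m \<and> m \<le> (1 + \<epsilon>) * \<mu>) \<and>
            measure_pmf.prob (D t n) {H. real (L H) \<le> (1 - \<epsilon>) * \<mu>}
              \<le> exp (- (1/24) * h * \<epsilon>\<^sup>2 * \<mu>) \<and>
            measure_pmf.prob (D t n) {H. real (L H) \<ge> (1 + \<epsilon>) * \<mu>}
              \<le> exp (- (1/24) * h * (\<epsilon>\<^sup>2 / (1 + \<epsilon>)) * \<mu>))"
proof -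
  \<comment> \<open>The cap meets the requirement of accuracy at most 1 in both bounds, and halving
    leaves room for \<open>(1 + \<delta> / 2) * (1 + \<delta>) \<le> 1 + 2 * \<delta> \<le> 1 +
    \<epsilon>\<close> in the upper bound on the expectation.\<close>
  define \<delta> where "\<delta> = min \<epsilon> 1 / 2"
  have \<delta>: "0 < \<delta>" "\<delta> \<le> 1" "2 * \<delta> \<le> \<epsilon>" "2 * \<delta> \<le> 1" using \<epsilon> by (auto simp: \<delta>_def)
  have \<delta>2: "0 < \<delta> / 2" "\<delta> / 2 \<le> 1" using \<delta> by auto
  have med': "approximate_median_on UNIV D c lam \<theta>"
    using med by (simp add: approximate_median_def approximate_median_on_def)
  have map: "map_pmf (\<lambda>H. relabel (consecutive_block n q k) ` induced (consecutive_block n q k) H) (D t n)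
      = D t (\<lambda>i. n i div q)" if "k < q" for t n q k
  proof -
    have "map_pmf (\<lambda>H. relabel (consecutive_block n q k) ` induced (consecutive_block n q k) H) (D t n)
        = D t (\<lambda>i. card (consecutive_block n q k i))"
      by (rule model_map[OF model]) (rule consecutive_block_subset[OF that])
    then show ?thesis by (simp add: card_consecutive_block)
  qed
  obtain t1 A1 where lower: "\<forall>t\<ge>t1. \<forall>n\<in>UNIV. (\<forall>i. n i > 0) \<longrightarrow> geo_mean n \<ge> A1 * t powr lam \<longrightarrow>
      class_size_sum n \<le> g t * geo_mean n \<longrightarrow>
      (1 - \<delta>) * (c * geo_mean n / t powr lam) \<le> measure_pmf.expectation (D t n) (\<lambda>H. real (L H)) \<and>
      (\<forall>m. is_median_L (D t n) m \<longrightarrow> (1 - \<delta>) * (c * geo_mean n / t powr lam) \<le> m)"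
    using lower_bound[OF h c lam \<eta> \<eta>_le gap g model_support[OF model] UNIV_I map cc med' \<delta>(1,2)] by blast
  obtain t2 A2 where upper: "\<forall>t\<ge>t2. \<forall>n. (\<forall>i. n i > 0) \<longrightarrow> geo_mean n \<ge> A2 * t powr lam \<longrightarrow>
      class_size_sum n \<le> g t * geo_mean n \<longrightarrow>
      (\<forall>m. is_median_L (D t n) m \<longrightarrow> m \<le> (1 + \<delta>) * (c * geo_mean n / t powr lam))"
    using upper_bound[OF h c lam \<eta> gap g model cc med' \<delta>(1,2)] by blast
  obtain R where R: "R \<ge> 1" and near: "\<forall>(F :: ('d \<Rightarrow> nat) set pmf) m.
     finite (set_pmf F) \<longrightarrow> concentration_constant F h \<longrightarrow> is_median_L F m \<longrightarrow> R \<le> m \<longrightarrow>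
     (1 - \<delta> / 2) * m \<le> measure_pmf.expectation F (\<lambda>H. real (L H)) \<and>
     measure_pmf.expectation F (\<lambda>H. real (L H)) \<le> (1 + \<delta> / 2) * m"
    using expectation_near_median[OF h \<delta>2, where ?'d = 'd] .
  \<comment> \<open>\<open>2 * R / c\<close> gives \<open>\<mu> \<ge> 2 * R\<close>, so that every
    median is at least \<open>R\<close>.\<close>
  define A where "A = max (max A1 A2) (max (2 * R / c) (24 * ln 2 * (1 + \<epsilon>) / (h * \<epsilon>\<^sup>2 * c)))"
  have A: "A1 \<le> A" "A2 \<le> A" "2 * R / c \<le> A" "24 * ln 2 * (1 + \<epsilon>) / (h * \<epsilon>\<^sup>2 * c) \<le> A"
    by (auto simp: A_def)
  show ?thesis
  proof (rule exI[of _ "max 1 (max t1 t2)"], rule exI[of _ A], intro allI impI, elim conjE)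
    fix t and n :: "'d \<Rightarrow> nat"
    assume t: "t \<ge> max 1 (max t1 t2)" and n: "\<forall>i. n i > 0" and N: "geo_mean n \<ge> A * t powr lam"
      and S: "class_size_sum n \<le> g t * geo_mean n"
    define \<mu> where "\<mu> = c * geo_mean n / t powr lam"
    let ?E = "measure_pmf.expectation (D t n) (\<lambda>H. real (L H))"
    have Z: "t powr lam > 0" using t by simp
    note big = large_mean[OF c h \<epsilon> Z N A(4), folded \<mu>_def]
    have "A1 * t powr lam \<le> A * t powr lam" "A2 * t powr lam \<le> A * t powr lam"
      using A by (auto intro!: mult_right_mono)
    then have N12: "A1 * t powr lam \<le> geo_mean n" "A2 * t powr lam \<le> geo_mean n" using N by linarith+
    have lo: "(1 - \<delta>) * \<mu> \<le> ?E" "\<And>m. is_median_L (D t n) m \<Longrightarrow> (1 - \<delta>) * \<mu> \<le> m"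
      using lower t n N12 S by (auto simp: \<mu>_def)
    have up: "\<And>m. is_median_L (D t n) m \<Longrightarrow> m \<le> (1 + \<delta>) * \<mu>"
      using upper t n N12 S by (auto simp: \<mu>_def)
    have weaken: "(1 - \<epsilon>) * \<mu> \<le> (1 - \<delta>) * \<mu>" "(1 + \<delta>) * \<mu> \<le> (1 + \<epsilon>) * \<mu>"
      using \<delta> big(2) by (auto intro!: mult_right_mono)
    have fin: "finite (set_pmf (D t n))" using finite_set_pmf_hypergraph[OF model_support[OF model]] .
    obtain m where m: "is_median_L (D t n) m" using median_exists[OF fin] .
    have "R \<le> m"
    proof -
      have "2 * R \<le> \<mu>" using A(3) big(1) c by (simp add: pos_divide_le_eq mult.commute)
      moreover have "1 / 2 * \<mu> \<le> (1 - \<delta>) * \<mu>" using \<delta> big(2) by (intro mult_right_mono) auto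
      ultimately show ?thesis using lo(2)[OF m] by linarith
    qed
    then have "?E \<le> (1 + \<delta> / 2) * m" using near fin cc m by blast
    also have "\<dots> \<le> (1 + \<delta> / 2) * ((1 + \<delta>) * \<mu>)" using up[OF m] \<delta> by (intro mult_left_mono) auto
    also have "\<dots> = ((1 + \<delta> / 2) * (1 + \<delta>)) * \<mu>" by simp
    also have "\<dots> \<le> (1 + \<epsilon>) * \<mu>"
    proof (rule mult_right_mono)
      have "\<delta> * \<delta> \<le> \<delta>" using \<delta> mult_left_mono[of \<delta> 1 \<delta>] by simp
      moreover have "(1 + \<delta> / 2) * (1 + \<delta>) = 1 + 3 / 2 * \<delta> + \<delta> * \<delta> / 2"
        by (simp add: algebra_simps add_divide_distrib)
      ultimately show "(1 + \<delta> / 2) * (1 + \<delta>) \<le> 1 + \<epsilon>" using \<delta> by linarith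
    qed (use big in simp)
    finally have E_up: "?E \<le> (1 + \<epsilon>) * \<mu>" .
    note mb = lo(2)[OF m, unfolded \<delta>_def] and mu = up[OF m, unfolded \<delta>_def]
    show "let \<mu> = c * geo_mean n / t powr lam in
            (1 - \<epsilon>) * \<mu> \<le> ?E \<and> ?E \<le> (1 + \<epsilon>) * \<mu> \<and>
            (\<forall>m. is_median_L (D t n) m \<longrightarrow> (1 - \<epsilon>) * \<mu> \<le> m \<and> m \<le> (1 + \<epsilon>) * \<mu>) \<and>
            measure_pmf.prob (D t n) {H. real (L H) \<le> (1 - \<epsilon>) * \<mu>}
              \<le> exp (- (1/24) * h * \<epsilon>\<^sup>2 * \<mu>) \<and>
            measure_pmf.prob (D t n) {H. real (L H) \<ge> (1 + \<epsilon>) * \<mu>}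
              \<le> exp (- (1/24) * h * (\<epsilon>\<^sup>2 / (1 + \<epsilon>)) * \<mu>)"
      unfolding Let_def \<mu>_def[symmetric]
      using lower_tail_near_median[OF cc h \<epsilon> big(2) m mb big(3)]
        upper_tail_near_median[OF cc h \<epsilon> big(2) m mb mu big(3)] E_up lo up weaken
      by (meson order_trans)
  qed
qed

lemma weak_model_bounds:
  fixes W :: "real \<Rightarrow> nat \<Rightarrow> ('d::finite \<Rightarrow> nat) set pmf" and h c lam \<theta> \<eta> :: real
  assumes h: "h > 0" and c: "c > 0" and lam: "lam \<ge> 0" and \<eta>: "0 \<le> \<eta>"
    and \<eta>_le: "CARD('d) \<ge> 2 \<Longrightarrow> \<eta> \<le> lam / (real CARD('d) - 1)"
    and gap: "\<eta> < \<theta> - lam" and g: "g \<in> O[at_top](\<lambda>t. t powr \<eta>)"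
    and model: "\<And>t. weak_random_hypergraph_model (W t)"
    and cc: "\<And>t n. concentration_constant (W t n) h"
    and med: "weak_approximate_median W c lam \<theta>" and \<epsilon>: "\<epsilon> > 0"
  shows "\<exists>t0 A. \<forall>t\<ge>t0. \<forall>n>0.
         real n \<ge> A * t powr lam \<and> real CARD('d) * real n \<le> g t * real n \<longrightarrow>
         (let \<mu> = c * real n / t powr lam in
            (1 - \<epsilon>) * \<mu> \<le> measure_pmf.expectation (W t n) (\<lambda>H. real (L H)) \<and>
            (\<forall>m. is_median_L (W t n) m \<longrightarrow> (1 - \<epsilon>) * \<mu> \<le> m) \<and>
            measure_pmf.prob (W t n) {H. real (L H) \<le> (1 - \<epsilon>) * \<mu>}
              \<le> exp (- (1/24) * h * \<epsilon>\<^sup>2 * \<mu>))"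
proof -
  \<comment> \<open>The weak model is read as a family over constant size vectors, \<open>D\<close>
    taking the common size from an arbitrary class.\<close>
  define C :: "('d \<Rightarrow> nat) set" where "C = range (\<lambda>k _. k)"
  define D where "D t n = W t (n (undefined :: 'd))" for t and n :: "'d \<Rightarrow> nat"
  define \<delta> where "\<delta> = min \<epsilon> 1 / 2"
  have \<delta>: "0 < \<delta>" "\<delta> \<le> 1" "\<delta> \<le> \<epsilon>" using \<epsilon> by (auto simp: \<delta>_def)
  have sum_const: "class_size_sum (\<lambda>_ :: 'd. k) = real CARD('d) * real k" for k
    by (simp add: class_size_sum_def)
  have weak_supp: "set_pmf (W t k) \<subseteq> Pow (complete_hypergraph (\<lambda>_. k))" for t k
    using model[of t] by (simp add: weak_random_hypergraph_model_def)
  have supp: "set_pmf (D t n) \<subseteq> Pow (complete_hypergraph n)" if "n \<in> C" for t n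
    using that weak_supp by (auto simp: C_def D_def)
  have div: "(\<lambda>i. n i div q) \<in> C" if "n \<in> C" for n q
    using that by (auto simp: C_def)
  have map: "map_pmf (\<lambda>H. relabel (consecutive_block n q k) ` induced (consecutive_block n q k) H) (D t n)
      = D t (\<lambda>i. n i div q)" if "n \<in> C" "k < q" for t n q k
  proof -
    obtain l where l: "n = (\<lambda>_. l)" using \<open>n \<in> C\<close> by (auto simp: C_def)
    \<comment> \<open>With equal classes a consecutive block has the same vertex set
      \<open>B\<close> in every class, as the monotonicity of a weak model requires.\<close>
    define B where "B = consecutive_block (\<lambda>_ :: 'd. l) q k undefined"
    have B: "consecutive_block n q k = (\<lambda>_. B)" by (simp add: B_def l consecutive_block_def fun_eq_iff)
    have "B \<subseteq> {1..l}" unfolding B_def by (rule consecutive_block_subset[OF \<open>k < q\<close>])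
    then have "map_pmf (\<lambda>H. relabel (\<lambda>_. B) ` induced (\<lambda>_. B) H) (W t l) = W t (card B)"
      using model[of t] by (simp add: weak_random_hypergraph_model_def)
    then show ?thesis unfolding B by (simp add: D_def l B_def card_consecutive_block)
  qed
  have med': "approximate_median_on C D c lam \<theta>"
    unfolding approximate_median_on_def
  proof (intro allI impI)
    fix e :: real assume "e > 0"
    then obtain a b t' where *: "\<forall>t\<ge>t'. \<forall>n>0.
        real n \<ge> a * t powr lam \<longrightarrow> real CARD('d) * real n * b \<le> t powr \<theta> \<longrightarrow>
        (\<forall>m. is_median_L (W t n) m \<longrightarrow>
           m \<in> {(1 - e) * (c * real n / t powr lam) .. (1 + e) * (c * real n / t powr lam)})"
      using med unfolding weak_approximate_median_def by blast
    show "\<exists>a b t'. \<forall>t\<ge>t'. \<forall>n\<in>C. (\<forall>i. n i > 0) \<longrightarrow>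
        geo_mean n \<ge> a * t powr lam \<longrightarrow> class_size_sum n * b \<le> t powr \<theta> \<longrightarrow>
        (\<forall>m. is_median_L (D t n) m \<longrightarrow>
           m \<in> {(1 - e) * (c * geo_mean n / t powr lam) .. (1 + e) * (c * geo_mean n / t powr lam)})"
    proof (rule exI[of _ a], rule exI[of _ b], rule exI[of _ t'], intro allI impI ballI)
      fix t n m
      assume A: "t \<ge> t'" "n \<in> C" "\<forall>i. n i > 0" "geo_mean n \<ge> a * t powr lam"
        "class_size_sum n * b \<le> t powr \<theta>" "is_median_L (D t n) m"
      then obtain l where l: "n = (\<lambda>_. l)" by (auto simp: C_def)
      show "m \<in> {(1 - e) * (c * geo_mean n / t powr lam) .. (1 + e) * (c * geo_mean n / t powr lam)}"
        using *[rule_format, of t l m] A unfolding l geo_mean_const sum_const D_def by blast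
    qed
  qed
  obtain t1 A1 where lower: "\<forall>t\<ge>t1. \<forall>n\<in>C. (\<forall>i. n i > 0) \<longrightarrow> geo_mean n \<ge> A1 * t powr lam \<longrightarrow>
      class_size_sum n \<le> g t * geo_mean n \<longrightarrow>
      (1 - \<delta>) * (c * geo_mean n / t powr lam) \<le> measure_pmf.expectation (D t n) (\<lambda>H. real (L H)) \<and>
      (\<forall>m. is_median_L (D t n) m \<longrightarrow> (1 - \<delta>) * (c * geo_mean n / t powr lam) \<le> m)"
    using lower_bound[OF h c lam \<eta> \<eta>_le gap g supp div map _ med' \<delta>(1,2)] cc
    unfolding D_def by blast
  define A where "A = max A1 (24 * ln 2 * (1 + \<epsilon>) / (h * \<epsilon>\<^sup>2 * c))"
  have A: "A1 \<le> A" "24 * ln 2 * (1 + \<epsilon>) / (h * \<epsilon>\<^sup>2 * c) \<le> A" by (auto simp: A_def)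
  show ?thesis
  proof (rule exI[of _ "max 1 t1"], rule exI[of _ A], intro allI impI, elim conjE)
    fix t and n :: nat
    assume t: "t \<ge> max 1 t1" and n: "n > 0" and N: "real n \<ge> A * t powr lam"
      and S: "real CARD('d) * real n \<le> g t * real n"
    define \<mu> where "\<mu> = c * real n / t powr lam"
    let ?E = "measure_pmf.expectation (W t n) (\<lambda>H. real (L H))"
    have Z: "t powr lam > 0" using t by simp
    note big = large_mean[OF c h \<epsilon> Z N A(2), folded \<mu>_def]
    have "A1 * t powr lam \<le> A * t powr lam" using A by (auto intro!: mult_right_mono)
    then have N1: "A1 * t powr lam \<le> real n" using N by linarith
    have "(\<lambda>_. n) \<in> C" by (auto simp: C_def)
    from lower[rule_format, OF _ this, of t]
    have lo: "(1 - \<delta>) * \<mu> \<le> ?E" "\<And>m. is_median_L (W t n) m \<Longrightarrow> (1 - \<delta>) * \<mu> \<le> m"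
      using t n N1 S by (auto simp: \<mu>_def geo_mean_const sum_const D_def)
    have weaken: "(1 - \<epsilon>) * \<mu> \<le> (1 - \<delta>) * \<mu>" using \<delta> big(2) by (auto intro!: mult_right_mono)
    obtain m where m: "is_median_L (W t n) m"
      using median_exists finite_set_pmf_hypergraph[OF weak_supp] by blast
    show "let \<mu> = c * real n / t powr lam in
            (1 - \<epsilon>) * \<mu> \<le> ?E \<and> (\<forall>m. is_median_L (W t n) m \<longrightarrow> (1 - \<epsilon>) * \<mu> \<le> m) \<and>
            measure_pmf.prob (W t n) {H. real (L H) \<le> (1 - \<epsilon>) * \<mu>} \<le> exp (- (1/24) * h * \<epsilon>\<^sup>2 * \<mu>)"
      unfolding Let_def \<mu>_def[symmetric]
      using lower_tail_near_median[OF cc h \<epsilon> big(2) m lo(2)[OF m, unfolded \<delta>_def] big(3)] lo weaken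
      by (meson order_trans)
  qed
qed

theorem mainTheorem1:
  fixes D :: "real \<Rightarrow> ('d::finite \<Rightarrow> nat) \<Rightarrow> ('d \<Rightarrow> nat) set pmf"
    and W :: "real \<Rightarrow> nat \<Rightarrow> ('d \<Rightarrow> nat) set pmf"
    and h c lam \<theta> \<eta> :: real
    and g :: "real \<Rightarrow> real"
  assumes "h > 0" and "c > 0" and "lam \<ge> 0"
    and "0 \<le> \<eta>"
    and "CARD('d) \<ge> 2 \<Longrightarrow> \<eta> \<le> lam / (real CARD('d) - 1)"
    and "\<eta> < \<theta> - lam"
    and "g \<in> O[at_top](\<lambda>t. t powr \<eta>)"
  shows
    "((\<forall>t. random_hypergraph_model (D t)) \<and>
      (\<forall>t n. concentration_constant (D t n) h) \<and>
      approximate_median D c lam \<theta> \<longrightarrow>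
      (\<exists>K>0. \<forall>\<epsilon>>0. \<exists>t0 A. \<forall>t\<ge>t0. \<forall>n.
         (\<forall>i. n i > 0) \<and> geo_mean n \<ge> A * t powr lam \<and> class_size_sum n \<le> g t * geo_mean n \<longrightarrow>
         (let \<mu> = c * geo_mean n / t powr lam in
            (1 - \<epsilon>) * \<mu> \<le> measure_pmf.expectation (D t n) (\<lambda>H. real (L H)) \<and>
            measure_pmf.expectation (D t n) (\<lambda>H. real (L H)) \<le> (1 + \<epsilon>) * \<mu> \<and>
            (\<forall>m. is_median_L (D t n) m \<longrightarrow> (1 - \<epsilon>) * \<mu> \<le> m \<and> m \<le> (1 + \<epsilon>) * \<mu>) \<and>
            measure_pmf.prob (D t n) {H. real (L H) \<le> (1 - \<epsilon>) * \<mu>}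
              \<le> exp (- K * h * \<epsilon>\<^sup>2 * \<mu>) \<and>
            measure_pmf.prob (D t n) {H. real (L H) \<ge> (1 + \<epsilon>) * \<mu>}
              \<le> exp (- K * h * (\<epsilon>\<^sup>2 / (1 + \<epsilon>)) * \<mu>))))
     \<and>
     ((\<forall>t. weak_random_hypergraph_model (W t)) \<and>
      (\<forall>t n. concentration_constant (W t n) h) \<and>
      weak_approximate_median W c lam \<theta> \<longrightarrow>
      (\<exists>K>0. \<forall>\<epsilon>>0. \<exists>t0 A. \<forall>t\<ge>t0. \<forall>n>0.
         real n \<ge> A * t powr lam \<and> real CARD('d) * real n \<le> g t * real n \<longrightarrow>
         (let \<mu> = c * real n / t powr lam in
            (1 - \<epsilon>) * \<mu> \<le> measure_pmf.expectation (W t n) (\<lambda>H. real (L H)) \<and>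
            (\<forall>m. is_median_L (W t n) m \<longrightarrow> (1 - \<epsilon>) * \<mu> \<le> m) \<and>
            measure_pmf.prob (W t n) {H. real (L H) \<le> (1 - \<epsilon>) * \<mu>}
              \<le> exp (- K * h * \<epsilon>\<^sup>2 * \<mu>))))"
proof (intro conjI impI; (elim conjE)?)
  \<comment> \<open>In both parts \<open>K = 1/24\<close>, the constant of the two tail estimates,
    which is independent of \<open>\<epsilon>\<close>.\<close>
  assume "\<forall>t. random_hypergraph_model (D t)" "\<forall>t n. concentration_constant (D t n) h"
    "approximate_median D c lam \<theta>"
  then show "\<exists>K>0. \<forall>\<epsilon>>0. \<exists>t0 A. \<forall>t\<ge>t0. \<forall>n.
         (\<forall>i. n i > 0) \<and> geo_mean n \<ge> A * t powr lam \<and> class_size_sum n \<le> g t * geo_mean n \<longrightarrow>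
         (let \<mu> = c * geo_mean n / t powr lam in
            (1 - \<epsilon>) * \<mu> \<le> measure_pmf.expectation (D t n) (\<lambda>H. real (L H)) \<and>
            measure_pmf.expectation (D t n) (\<lambda>H. real (L H)) \<le> (1 + \<epsilon>) * \<mu> \<and>
            (\<forall>m. is_median_L (D t n) m \<longrightarrow> (1 - \<epsilon>) * \<mu> \<le> m \<and> m \<le> (1 + \<epsilon>) * \<mu>) \<and>
            measure_pmf.prob (D t n) {H. real (L H) \<le> (1 - \<epsilon>) * \<mu>}
              \<le> exp (- K * h * \<epsilon>\<^sup>2 * \<mu>) \<and>
            measure_pmf.prob (D t n) {H. real (L H) \<ge> (1 + \<epsilon>) * \<mu>}
              \<le> exp (- K * h * (\<epsilon>\<^sup>2 / (1 + \<epsilon>)) * \<mu>))"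
    by (intro exI[of _ "1/24"] conjI allI impI strong_model_bounds[OF assms]) auto
next
  assume "\<forall>t. weak_random_hypergraph_model (W t)" "\<forall>t n. concentration_constant (W t n) h"
    "weak_approximate_median W c lam \<theta>"
  then show "\<exists>K>0. \<forall>\<epsilon>>0. \<exists>t0 A. \<forall>t\<ge>t0. \<forall>n>0.
         real n \<ge> A * t powr lam \<and> real CARD('d) * real n \<le> g t * real n \<longrightarrow>
         (let \<mu> = c * real n / t powr lam in
            (1 - \<epsilon>) * \<mu> \<le> measure_pmf.expectation (W t n) (\<lambda>H. real (L H)) \<and>
            (\<forall>m. is_median_L (W t n) m \<longrightarrow> (1 - \<epsilon>) * \<mu> \<le> m) \<and>
            measure_pmf.prob (W t n) {H. real (L H) \<le> (1 - \<epsilon>) * \<mu>}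
              \<le> exp (- K * h * \<epsilon>\<^sup>2 * \<mu>))"
    by (intro exI[of _ "1/24"] conjI allI impI weak_model_bounds[OF assms]) auto
qed

end
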